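(* Let $L=K_1\cup\dots\cup K_\mu$ and $L'=K'_1\cup\dots\cup K'_{\mu'}$ be classical links and let $f:Q_A(L)\to Q_A(L')$ be a quandle isomorphism between their fundamental multivariate Alexander quandles. (It is known that then $\mu=\mu'$ and the components of $L$ and $L'$ can be re-indexed so that $L$ and $L'$ are indexed compatibly with $f$.) After such a re-indexing, $Q_A(L_S)\cong Q_A(L'_S)$ as quandles for every subset $S\subseteq\{1,\dots,\mu\}$.
   Context: Links are classical: oriented, tame, in $\mathbb{S}^3$, with indexed components. $\Lambda_\mu=\mathbb{Z}[t_1^{\pm1},\dots,t_\mu^{\pm1}]$ is the Laurent polynomial ring and $I_\mu$ is its ideal generated by $t_1-1,\dots,t_\mu-1$. Alexander module. Let $D$ be a diagram of $L=K_1\cup\dots\cup K_\mu$, with set of arcs $A(D)$ and set of crossings $C(D)$; $\kappa_D(a)=i$ means the arc $a$ belongs to the image of $K_i$. At a crossing $c$ let $a_{\mathrm{over}}$ be the overpassing arc, and let $a_{\mathrm{left}}$, $a_{\mathrm{right}}$ be the underpassing arcs lying to the left and to the right of $a_{\mathrm{over}}$ with respect to the orientation of $a_{\mathrm{over}}$. Let $\rho_D:\Lambda_\mu^{C(D)}\to\Lambda_\mu^{A(D)}$ be the $\Lambda_\mu$-linear map of free modules with $\rho_D(c)=(1-t_{\kappa_D(a_{\mathrm{left}})})a_{\mathrm{over}}+t_{\kappa_D(a_{\mathrm{over}})}a_{\mathrm{right}}-a_{\mathrm{left}}$. The Alexander module is $M_A(L)=\mathrm{coker}\,\rho_D$, with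 quotient map $\gamma_D:\Lambda_\mu^{A(D)}\to M_A(L)$, and the Crowell map $\phi_L:M_A(L)\to I_\mu$ is the $\Lambda_\mu$-linear map with $\phi_L(\gamma_D(a))=t_{\kappa_D(a)}-1$ for all $a\in A(D)$. Quandle. On $M_A(L)$ put $x\triangleright y=(\phi_L(y)+1)x-\phi_L(x)y$ and, whenever $\phi_L(y)+1$ is a unit of $\Lambda_\mu$, $x\triangleright^{-1}y=(\phi_L(y)+1)^{-1}(x+\phi_L(x)y)$. $Q_A(L)$ is the smallest subset of $M_A(L)$ that contains $\gamma_D(A(D))$ and is closed under $\triangleright,\triangleright^{-1}$. Up to isomorphism the triple $(M_A(L),\phi_L,Q_A(L))$ does not depend on $D$. A quandle isomorphism is a bijection preserving $\triangleright$ and $\triangleright^{-1}$. An orbit of $Q_A(L)$ is a minimal nonempty subset $X$ with $x\triangleright y,\ x\triangleright^{-1}y\in X$ for all $x\in X$, $y\in Q_A(L)$. $Q_A(L)$ has exactly $\mu$ orbits; the $K_i$ orbit $Q_A(L)_i$ is the one containing $\gamma_D(a)$ for every $a$ with $\kappa_D(a)=i$. Permuting the component indices of $L$ does not change the quandle $Q_A(L)$, only the labeling of its orbits. If $\mu=\mu'$ and $f:Q_A(L)\to Q_A(L')$ is a quandle isomorphism, $L$ and $L'$ are indexed compatibly with $f$ if $f(Q_A(L)_i)=Q_A(L')_i$ for each $i\in\{1,\dots,\mu\}$. For $S\subseteq\{1,\dots,\mu\}$, $L_S$ is the sublink of $L$ consisting of the components with indices in $S$ (its own Alexander module is formed after indexing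 these components by $1,\dots,|S|$, say in increasing order). For the empty link the definitions give $M_A=0$ and $Q_A=\emptyset$. *)

theory Defs
  imports
    "HOL-Analysis.Analysis"
    "HOL-Algebra.AbelCoset"
    "HOL-Algebra.Module"
    "HOL-Library.Poly_Mapping"
    "HOL-Combinatorics.Permutations"
begin

section \<open>Links and diagrams\<close>

text \<open>
  A link with \<open>\<mu>\<close> components is a list of \<open>\<mu>\<close> closed curves, each one given by a parametrization of
  period 1 whose direction is the orientation. List positions start at 0, so the index set is
  \<open>{..<\<mu>}\<close>. The 3-sphere is the one-point compactification of \<open>\<complex> \<times> \<real>\<close>.
\<close>

type_synonym space = "complex \<times> real"
type_synonym sphere3 = "space option"

abbreviation S3 :: "sphere3 topology"
  where "S3 \<equiv> Alexandroff_compactification euclidean"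

definition embedded_curves :: "(real \<Rightarrow> 'p) list \<Rightarrow> bool"
  where "embedded_curves L \<longleftrightarrow>
    (\<forall>K\<in>set L. \<forall>s. K (s + 1) = K s) \<and>
    (\<forall>i<length L. \<forall>j<length L. \<forall>s t. (L ! i) s = (L ! j) t \<longrightarrow> i = j \<and> s - t \<in> \<int>)"

definition C1_link :: "(real \<Rightarrow> space) list \<Rightarrow> bool"
  where "C1_link D \<longleftrightarrow> embedded_curves D \<and>
    (\<forall>K\<in>set D. K C1_differentiable_on UNIV \<and> (\<forall>s. vector_derivative K (at s) \<noteq> 0))"

text \<open>
  The final position is required to agree pointwise with the parametrization of \<open>M\<close>. For tame links
  this is no restriction: an orientation-preserving reparametrization of a component is realized
  by an isotopy inside a tubular neighbourhood.
\<close>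

definition ambient_isotopic :: "(real \<Rightarrow> sphere3) list \<Rightarrow> (real \<Rightarrow> sphere3) list \<Rightarrow> bool"
  where "ambient_isotopic L M \<longleftrightarrow> length L = length M \<and>
    (\<exists>H :: real \<times> sphere3 \<Rightarrow> sphere3.
      continuous_map (prod_topology (top_of_set {0..1}) S3) S3 H \<and>
      (\<forall>u\<in>{0..1}. homeomorphic_map S3 S3 (\<lambda>x. H (u, x))) \<and>
      (\<forall>x\<in>topspace S3. H (0, x) = x) \<and>
      (\<forall>i<length L. \<forall>s. H (1, (L ! i) s) = (M ! i) s))"

definition in_S3 :: "(real \<Rightarrow> space) list \<Rightarrow> (real \<Rightarrow> sphere3) list"
  where "in_S3 D = map (\<lambda>K s. Some (K s)) D"

text \<open>Tameness is the existence of an ambient isotopy to a regular \<open>C\<^sup>1\<close> link.\<close>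

definition classical_link :: "(real \<Rightarrow> sphere3) list \<Rightarrow> bool"
  where "classical_link L \<longleftrightarrow> embedded_curves L \<and>
    (\<forall>K\<in>set L. continuous_map euclideanreal S3 K) \<and>
    (\<exists>D. C1_link D \<and> ambient_isotopic (in_S3 D) L)"

text \<open>
  A diagram is a link in \<open>\<complex> \<times> \<real>\<close> whose projection to \<open>\<complex>\<close> is regular; the real coordinate
  is the height. A position \<open>(i, s)\<close> is the point with parameter \<open>s\<close> of component \<open>i\<close>, and a
  crossing is the pair of its overpassing and its underpassing position.
\<close>

type_synonym position = "nat \<times> real"
type_synonym crossing = "position \<times> position"
type_synonym diagram = "(real \<Rightarrow> space) list"
type_synonym arc = "space set"

definition point_at :: "diagram \<Rightarrow> position \<Rightarrow> space"
  where "point_at D p = (D ! fst p) (snd p)"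

definition direction_at :: "diagram \<Rightarrow> position \<Rightarrow> complex"
  where "direction_at D p = vector_derivative (\<lambda>s. fst ((D ! fst p) s)) (at (snd p))"

definition positions :: "diagram \<Rightarrow> position set"
  where "positions D = {..<length D} \<times> {0..<1}"

definition crossings :: "diagram \<Rightarrow> crossing set"
  where "crossings D = {(p, q). p \<in> positions D \<and> q \<in> positions D \<and>
    fst (point_at D p) = fst (point_at D q) \<and> snd (point_at D p) > snd (point_at D q)}"

text \<open>\<open>cross2 u v > 0\<close> means that \<open>v\<close> points to the left of \<open>u\<close>.\<close>

definition cross2 :: "complex \<Rightarrow> complex \<Rightarrow> real"
  where "cross2 u v = Re u * Im v - Im u * Re v"

text \<open>The last condition excludes triple points, which would give several crossings over one point.\<close>

definition regular_diagram :: "diagram \<Rightarrow> bool"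
  where "regular_diagram D \<longleftrightarrow> C1_link D \<and>
    (\<forall>p. fst p < length D \<longrightarrow> direction_at D p \<noteq> 0) \<and>
    finite (crossings D) \<and>
    (\<forall>(p, q)\<in>crossings D. cross2 (direction_at D p) (direction_at D q) \<noteq> 0) \<and>
    inj_on (\<lambda>(p, q). fst (point_at D p)) (crossings D)"

definition diagram_of :: "diagram \<Rightarrow> (real \<Rightarrow> sphere3) list \<Rightarrow> bool"
  where "diagram_of D L \<longleftrightarrow> regular_diagram D \<and> ambient_isotopic (in_S3 D) L"

text \<open>
  Both operations below apply to links and to diagrams. The sublink on an index set \<open>S\<close> is
  \<open>nths L S\<close>, with its components in increasing order of their indices.
\<close>

definition reindex :: "(nat \<Rightarrow> nat) \<Rightarrow> (real \<Rightarrow> 'p) list \<Rightarrow> (real \<Rightarrow> 'p) list"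
  where "reindex \<pi> L = permute_list \<pi> L"

definition sublink :: "(real \<Rightarrow> 'p) list \<Rightarrow> nat set \<Rightarrow> (real \<Rightarrow> 'p) list"
  where "sublink L S = nths L S"

text \<open>
  The arcs are the connected pieces left after removing the underpassing points. They are taken on the
  curves in space, where, unlike in the plane, the two strands of a crossing do not meet.
\<close>

definition under_points :: "diagram \<Rightarrow> space set"
  where "under_points D = (\<lambda>c. point_at D (snd c)) ` crossings D"

definition arcs_of_component :: "diagram \<Rightarrow> nat \<Rightarrow> arc set"
  where "arcs_of_component D i = components (range (D ! i) - under_points D)"

definition arcs :: "diagram \<Rightarrow> arc set"
  where "arcs D = (\<Union>i<length D. arcs_of_component D i)"

definition arc_index :: "diagram \<Rightarrow> arc \<Rightarrow> nat"
  where "arc_index D a = (THE i. i < length D \<and> a \<in> arcs_of_component D i)"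

definition over_arc :: "diagram \<Rightarrow> crossing \<Rightarrow> arc"
  where "over_arc D c = (THE a. a \<in> arcs D \<and> point_at D (fst c) \<in> a)"

definition incoming_arc :: "diagram \<Rightarrow> crossing \<Rightarrow> arc"
  where "incoming_arc D c = (THE a. a \<in> arcs D \<and>
    (\<forall>\<^sub>F s in at_left (snd (snd c)). point_at D (fst (snd c), s) \<in> a))"

definition outgoing_arc :: "diagram \<Rightarrow> crossing \<Rightarrow> arc"
  where "outgoing_arc D c = (THE a. a \<in> arcs D \<and>
    (\<forall>\<^sub>F s in at_right (snd (snd c)). point_at D (fst (snd c), s) \<in> a))"

definition under_goes_left :: "diagram \<Rightarrow> crossing \<Rightarrow> bool"
  where "under_goes_left D c \<longleftrightarrow> cross2 (direction_at D (fst c)) (direction_at D (snd c)) > 0"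

definition left_arc :: "diagram \<Rightarrow> crossing \<Rightarrow> arc"
  where "left_arc D c = (if under_goes_left D c then outgoing_arc D c else incoming_arc D c)"

definition right_arc :: "diagram \<Rightarrow> crossing \<Rightarrow> arc"
  where "right_arc D c = (if under_goes_left D c then incoming_arc D c else outgoing_arc D c)"


section \<open>Laurent polynomials and modules\<close>

text \<open>
  The type contains Laurent polynomials in \<open>t\<^sub>0, t\<^sub>1, \<dots>\<close> as finitely supported functions from exponent
  vectors to coefficients. The ring \<open>\<Lambda>\<^sub>n\<close> consists of those involving only \<open>t\<^sub>i\<close> with \<open>i < n\<close>.
\<close>

type_synonym laurent = "(nat \<Rightarrow>\<^sub>0 int) \<Rightarrow>\<^sub>0 int"

definition laurent_var :: "nat \<Rightarrow> laurent"
  where "laurent_var i = Poly_Mapping.single (Poly_Mapping.single i 1) 1"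

definition laurent_ring :: "nat \<Rightarrow> laurent ring"
  where "laurent_ring n =
    \<lparr>carrier = {p. \<forall>m\<in>Poly_Mapping.keys p. Poly_Mapping.keys m \<subseteq> {..<n}},
     monoid.mult = (*), one = 1, ring.zero = 0, add = (+)\<rparr>"

definition scale :: "laurent \<Rightarrow> ('x \<Rightarrow>\<^sub>0 laurent) \<Rightarrow> ('x \<Rightarrow>\<^sub>0 laurent)"
  where "scale r v = Poly_Mapping.map (\<lambda>q. r * q) v"

text \<open>The ring multiplication inherited by the module record type is irrelevant.\<close>

definition free_module :: "nat \<Rightarrow> 'x set \<Rightarrow> (laurent, 'x \<Rightarrow>\<^sub>0 laurent) module"
  where "free_module n X =
    \<lparr>carrier = {v. Poly_Mapping.keys v \<subseteq> X \<and>
                   (\<forall>x. Poly_Mapping.lookup v x \<in> carrier (laurent_ring n))},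
     monoid.mult = undefined, one = undefined, ring.zero = 0, add = (+), smult = scale\<rparr>"

definition quotient_module :: "('r, 'm) module \<Rightarrow> 'm set \<Rightarrow> ('r, 'm set) module"
  where "quotient_module M N =
    \<lparr>carrier = a_rcosets\<^bsub>M\<^esub> N,
     monoid.mult = undefined, one = undefined, ring.zero = N, add = set_add M,
     smult = (\<lambda>r X. \<Union>x\<in>X. N +>\<^bsub>M\<^esub> (r \<odot>\<^bsub>M\<^esub> x))\<rparr>"


section \<open>The Alexander module and the Crowell map\<close>

definition crossing_relation :: "diagram \<Rightarrow> crossing \<Rightarrow> arc \<Rightarrow>\<^sub>0 laurent"
  where "crossing_relation D c =
    Poly_Mapping.single (over_arc D c) (1 - laurent_var (arc_index D (left_arc D c)))
    + Poly_Mapping.single (right_arc D c) (laurent_var (arc_index D (over_arc D c)))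
    - Poly_Mapping.single (left_arc D c) 1"

definition rho :: "diagram \<Rightarrow> (crossing \<Rightarrow>\<^sub>0 laurent) \<Rightarrow> (arc \<Rightarrow>\<^sub>0 laurent)"
  where "rho D w =
    (\<Sum>c\<in>Poly_Mapping.keys w. scale (Poly_Mapping.lookup w c) (crossing_relation D c))"

abbreviation arc_module :: "diagram \<Rightarrow> (laurent, arc \<Rightarrow>\<^sub>0 laurent) module"
  where "arc_module D \<equiv> free_module (length D) (arcs D)"

definition relations :: "diagram \<Rightarrow> (arc \<Rightarrow>\<^sub>0 laurent) set"
  where "relations D = rho D ` carrier (free_module (length D) (crossings D))"

type_synonym alexander_element = "(arc \<Rightarrow>\<^sub>0 laurent) set"

definition alexander_module :: "diagram \<Rightarrow> (laurent, alexander_element) module"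
  where "alexander_module D = quotient_module (arc_module D) (relations D)"

definition gamma :: "diagram \<Rightarrow> (arc \<Rightarrow>\<^sub>0 laurent) \<Rightarrow> alexander_element"
  where "gamma D v = relations D +>\<^bsub>arc_module D\<^esub> v"

definition arc_class :: "diagram \<Rightarrow> arc \<Rightarrow> alexander_element"
  where "arc_class D a = gamma D (Poly_Mapping.single a 1)"

text \<open>
  The linear map on the free module with value \<open>t\<^sub>i - 1\<close> at an arc of index \<open>i\<close> is constant on the
  cosets of \<open>relations D\<close>; the Crowell map assigns to a coset the common value.
\<close>

definition crowell :: "diagram \<Rightarrow> alexander_element \<Rightarrow> laurent"
  where "crowell D X = the_elem ((\<lambda>v. \<Sum>a\<in>Poly_Mapping.keys v.
    Poly_Mapping.lookup v a * (laurent_var (arc_index D a) - 1)) ` X)"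


section \<open>Quandles\<close>

record 'a quandle = "'a partial_object" +
  rop :: "'a \<Rightarrow> 'a \<Rightarrow> 'a"  (infixl \<open>\<triangleright>\<index>\<close> 70)
  rop_inv :: "'a \<Rightarrow> 'a \<Rightarrow> 'a"  (infixl \<open>\<triangleleft>\<index>\<close> 70)

definition quandle_isos :: "'a quandle \<Rightarrow> 'b quandle \<Rightarrow> ('a \<Rightarrow> 'b) set"
  where "quandle_isos Q R = {f. bij_betw f (carrier Q) (carrier R) \<and>
    (\<forall>x\<in>carrier Q. \<forall>y\<in>carrier Q.
      f (x \<triangleright>\<^bsub>Q\<^esub> y) = f x \<triangleright>\<^bsub>R\<^esub> f y \<and> f (x \<triangleleft>\<^bsub>Q\<^esub> y) = f x \<triangleleft>\<^bsub>R\<^esub> f y)}"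

definition quandle_isomorphic :: "'a quandle \<Rightarrow> 'b quandle \<Rightarrow> bool"
  where "quandle_isomorphic Q R \<longleftrightarrow> quandle_isos Q R \<noteq> {}"

definition stable_subset :: "'a quandle \<Rightarrow> 'a set \<Rightarrow> bool"
  where "stable_subset Q X \<longleftrightarrow> X \<noteq> {} \<and> X \<subseteq> carrier Q \<and>
    (\<forall>x\<in>X. \<forall>y\<in>carrier Q. x \<triangleright>\<^bsub>Q\<^esub> y \<in> X \<and> x \<triangleleft>\<^bsub>Q\<^esub> y \<in> X)"

definition quandle_orbits :: "'a quandle \<Rightarrow> 'a set set"
  where "quandle_orbits Q =
    {X. stable_subset Q X \<and> (\<forall>Y. stable_subset Q Y \<and> Y \<subseteq> X \<longrightarrow> Y = X)}"

definition alexander_op :: "diagram \<Rightarrow> alexander_element \<Rightarrow> alexander_element \<Rightarrow> alexander_element"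
  where "alexander_op D x y =
    ((crowell D y + 1) \<odot>\<^bsub>alexander_module D\<^esub> x)
      \<ominus>\<^bsub>alexander_module D\<^esub> (crowell D x \<odot>\<^bsub>alexander_module D\<^esub> y)"

definition alexander_op_inv :: "diagram \<Rightarrow> alexander_element \<Rightarrow> alexander_element \<Rightarrow> alexander_element"
  where "alexander_op_inv D x y =
    (inv\<^bsub>laurent_ring (length D)\<^esub> (crowell D y + 1)) \<odot>\<^bsub>alexander_module D\<^esub>
      (x \<oplus>\<^bsub>alexander_module D\<^esub> (crowell D x \<odot>\<^bsub>alexander_module D\<^esub> y))"

inductive_set alexander_set :: "diagram \<Rightarrow> alexander_element set" for D
  where
    generator: "a \<in> arcs D \<Longrightarrow> arc_class D a \<in> alexander_set D"
  | op: "x \<in> alexander_set D \<Longrightarrow> y \<in> alexander_set D \<Longrightarrow> alexander_op D x y \<in> alexander_set D"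
  | op_inv: "x \<in> alexander_set D \<Longrightarrow> y \<in> alexander_set D \<Longrightarrow>
      crowell D y + 1 \<in> Units (laurent_ring (length D)) \<Longrightarrow> alexander_op_inv D x y \<in> alexander_set D"

definition alexander_quandle :: "diagram \<Rightarrow> alexander_element quandle"
  where "alexander_quandle D =
    \<lparr>carrier = alexander_set D, rop = alexander_op D, rop_inv = alexander_op_inv D\<rparr>"

definition component_orbit :: "diagram \<Rightarrow> nat \<Rightarrow> alexander_element set"
  where "component_orbit D i = (THE X. X \<in> quandle_orbits (alexander_quandle D) \<and>
    (\<forall>a\<in>arcs D. arc_index D a = i \<longrightarrow> arc_class D a \<in> X))"

text \<open>
  Re-indexing leaves the quandle unchanged and only relabels its orbits: component \<open>i\<close> of
  \<open>reindex \<pi> D\<close> is component \<open>\<pi> i\<close> of \<open>D\<close>, so the orbit labelled \<open>i\<close> after re-indexing is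
  \<open>component_orbit D (\<pi> i)\<close>. The predicate says that \<open>f\<close> is compatible with the new indices.
\<close>

definition compatible_reindexing ::
  "diagram \<Rightarrow> diagram \<Rightarrow> (alexander_element \<Rightarrow> alexander_element) \<Rightarrow>
   (nat \<Rightarrow> nat) \<Rightarrow> (nat \<Rightarrow> nat) \<Rightarrow> bool"
  where "compatible_reindexing D D' f \<pi> \<pi>' \<longleftrightarrow>
    \<pi> permutes {..<length D} \<and> \<pi>' permutes {..<length D'} \<and> length D = length D' \<and>
    (\<forall>i<length D. f ` component_orbit D (\<pi> i) = component_orbit D' (\<pi>' i))"

end

theory Submission
  imports Defs
begin

text \<open>
  Write \<open>Q\<^sub>i\<close> for the \<open>K\<^sub>i\<close> orbit of \<open>Q\<^sub>A(L)\<close>. The Crowell map does not change when its argument is acted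
  upon, and the relation of a crossing says that its left arc is its right arc acted upon by its
  over arc, so all arcs of one component lie in one orbit. Hence \<open>Q\<^sub>i\<close> is the part of \<open>Q\<^sub>A(L)\<close> on
  which the Crowell map is \<open>t\<^sub>i - 1\<close>, there is one orbit per component, and an isomorphism \<open>f\<close>
  carries orbits to orbits. This gives the equality of the numbers of components and a re-indexing.

  On \<open>Q\<^sub>i \<times> Q\<^sub>j\<close> the operation is the linear expression \<open>t\<^sub>j x - (t\<^sub>i - 1) y\<close>. So for an \<open>f\<close> that
  respects the indices, the images of the arcs satisfy the crossing relations again: what looks
  like a mere quandle map is the restriction of a linear map. For a sublink the argument is run
  after a projection. Let \<open>E\<close> be obtained from the diagram \<open>D\<close> by deleting components. Setting the
  deleted variables to 1 and the deleted arcs to 0 gives a semilinear map from the Alexander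
  module of \<open>D\<close> to that of \<open>E\<close> (\<open>project\<close>). It sends the deleted orbits to 0, so acting by their
  elements becomes trivial, and it sends the other orbits into those of \<open>E\<close>.

  Now let \<open>f\<close> go from \<open>Q\<^sub>A\<close> of \<open>D\<close> to \<open>Q\<^sub>A\<close> of \<open>D'\<close> and let \<open>E'\<close> be the matching subdiagram of \<open>D'\<close>.
  Apart from finitely many points, an arc of \<open>E\<close> is a union of arcs of \<open>D\<close>, separated only by
  crossings under deleted components. Applying \<open>f\<close> and then the projection of \<open>D'\<close> (\<open>transfer\<close>) gives these arcs of \<open>D\<close> the
  same value, because the action of a deleted element is trivial after projection. This assigns a
  value to each arc of \<open>E\<close>, the values satisfy the crossing relations of \<open>E\<close>, and the universal
  property of the cokernel yields a linear map between the Alexander modules of \<open>E\<close> and \<open>E'\<close>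
  (\<open>comparison\<close>). Linear maps compatible with the Crowell maps preserve both quandle operations.
  The maps built from \<open>f\<close> and from its inverse undo each other on arcs, hence everywhere
  (\<open>comparison_inverse\<close>).

  The geometry enters through one fact on simple closed curves (\<open>gluing\<close>): cut the curve at a finite set
  \<open>W\<close>; a function on the pieces that agrees on the two sides of each point of \<open>W - U\<close> is constant on
  each piece of the coarser cut at \<open>U\<close>. With \<open>U\<close> empty it shows that the arcs of a component lie in
  one orbit; with \<open>U\<close> the underpassing points of \<open>E\<close> it shows that the value at an arc of \<open>E\<close> is
  well defined.
\<close>

section \<open>Finitely supported functions and semilinear maps\<close>

text \<open>
  Both semilinear maps of free modules and homomorphisms of Laurent polynomial rings are determined
  by their values on monomials. The sum below is that extension, with \<open>F k\<close> the map on multiples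
  of the basis element \<open>k\<close>.
\<close>

definition extend :: "('k \<Rightarrow> 'c::zero \<Rightarrow> 'm::comm_monoid_add) \<Rightarrow> ('k \<Rightarrow>\<^sub>0 'c) \<Rightarrow> 'm"
  where "extend F v = (\<Sum>k\<in>Poly_Mapping.keys v. F k (Poly_Mapping.lookup v k))"

lemma extend_superset:
  assumes "finite A" "Poly_Mapping.keys v \<subseteq> A" "\<And>k. F k 0 = 0"
  shows "extend F v = (\<Sum>k\<in>A. F k (Poly_Mapping.lookup v k))"
  unfolding extend_def
  using assms by (intro sum.mono_neutral_left) (auto simp: in_keys_iff)

lemma additive_extend:
  fixes F :: "'k \<Rightarrow> 'c::ab_group_add \<Rightarrow> 'm::ab_group_add"
  assumes "\<And>k. Modules.additive (F k)"
  shows "Modules.additive (extend F)"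
proof
  fix v w :: "'k \<Rightarrow>\<^sub>0 'c"
  let ?A = "Poly_Mapping.keys v \<union> Poly_Mapping.keys w"
  have z: "F k 0 = 0" for k
    using assms additive.zero by blast
  have "extend F (v + w) = (\<Sum>k\<in>?A. F k (Poly_Mapping.lookup (v + w) k))"
    using z keys_add[of v w] by (intro extend_superset) auto
  also have "\<dots> = (\<Sum>k\<in>?A. F k (Poly_Mapping.lookup v k)) + (\<Sum>k\<in>?A. F k (Poly_Mapping.lookup w k))"
    using assms by (simp add: lookup_add additive.add sum.distrib)
  also have "\<dots> = extend F v + extend F w"
    using z by (simp add: extend_superset[of ?A])
  finally show "extend F (v + w) = extend F v + extend F w" .
qed

lemma extend_single:
  assumes "\<And>k. F k 0 = 0"
  shows "extend F (Poly_Mapping.single k c) = F k c"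
  using assms by (subst extend_superset[of "{k}"]) auto

lemma sum_of_singles: "v = (\<Sum>k\<in>Poly_Mapping.keys v. Poly_Mapping.single k (Poly_Mapping.lookup v k))"
  by (rule poly_mapping_eqI)
    (auto simp: lookup_sum lookup_single when_def in_keys_iff)

lemma additive_eqI:
  fixes f g :: "('k \<Rightarrow>\<^sub>0 'c::ab_group_add) \<Rightarrow> 'm::ab_group_add"
  assumes "Modules.additive f" "Modules.additive g"
    and "\<And>k c. f (Poly_Mapping.single k c) = g (Poly_Mapping.single k c)"
  shows "f v = g v"
  by (subst (1 2) sum_of_singles) (simp add: assms(3) additive.sum[OF assms(1)] additive.sum[OF assms(2)])

lemma additive_comp: "Modules.additive f \<Longrightarrow> Modules.additive g \<Longrightarrow> Modules.additive (\<lambda>x. f (g x))"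
  by (simp add: Modules.additive_def)

lemma additive_times_left: "Modules.additive ((*) (r::'a::ring))"
  by (simp add: Modules.additive_def distrib_left)

lemma additive_times_right: "Modules.additive (\<lambda>x. x * (r::'a::ring))"
  by (simp add: Modules.additive_def distrib_right)

lemma additive_single: "Modules.additive (Poly_Mapping.single k)"
  by (simp add: Modules.additive_def single_add)

lemma lookup_scale: "Poly_Mapping.lookup (scale r v) a = r * Poly_Mapping.lookup v a"
  by (simp add: scale_def Poly_Mapping.map.rep_eq when_def)

text \<open>
  Although the Alexander module has coefficients in \<open>\<Lambda>\<^sub>n\<close> only, the computations take place in modules over the
  whole type of Laurent polynomials; membership in \<open>\<Lambda>\<^sub>n\<close> is tracked separately.
\<close>

interpretation scaling: Modules.module scale
  by unfold_locales
    (auto intro!: poly_mapping_eqI simp: lookup_scale lookup_add algebra_simps)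

lemma scale_single: "scale r (Poly_Mapping.single a s) = Poly_Mapping.single a (r * s)"
  by (rule poly_mapping_eqI) (simp add: lookup_scale lookup_single when_def)

lemma keys_scale_subset: "Poly_Mapping.keys (scale r v) \<subseteq> Poly_Mapping.keys v"
  by (auto simp: in_keys_iff lookup_scale)

lemma additive_scale_right: "Modules.additive (scale r)"
  by (simp add: Modules.additive_def scaling.scale_right_distrib)

lemma additive_scale_left: "Modules.additive (\<lambda>r. scale r v)"
  by (simp add: Modules.additive_def scaling.scale_left_distrib)

section \<open>Laurent polynomial rings\<close>

lemma laurent_ring_sel [simp]:
  "mult (laurent_ring n) = (*)" "one (laurent_ring n) = 1"
  by (simp_all add: laurent_ring_def)

lemma laurent_zero [simp]: "0 \<in> carrier (laurent_ring n)"
  by (simp add: laurent_ring_def)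

lemma laurent_one [simp]: "1 \<in> carrier (laurent_ring n)"
  by (simp add: laurent_ring_def)

lemma laurent_add [simp]:
  "p \<in> carrier (laurent_ring n) \<Longrightarrow> q \<in> carrier (laurent_ring n) \<Longrightarrow> p + q \<in> carrier (laurent_ring n)"
  using keys_add[of p q] by (auto simp: laurent_ring_def)

lemma laurent_uminus [simp]: "p \<in> carrier (laurent_ring n) \<Longrightarrow> - p \<in> carrier (laurent_ring n)"
  by (auto simp: laurent_ring_def in_keys_iff)

lemma laurent_diff [simp]:
  "p \<in> carrier (laurent_ring n) \<Longrightarrow> q \<in> carrier (laurent_ring n) \<Longrightarrow> p - q \<in> carrier (laurent_ring n)"
  using laurent_add[of p n "- q"] by simp

lemma laurent_mult [simp]:
  assumes "p \<in> carrier (laurent_ring n)" "q \<in> carrier (laurent_ring n)"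
  shows "p * q \<in> carrier (laurent_ring n)"
proof -
  have "Poly_Mapping.keys e \<subseteq> {..<n}" if "e \<in> Poly_Mapping.keys (p * q)" for e
  proof -
    obtain a b where ab: "e = a + b" "a \<in> Poly_Mapping.keys p" "b \<in> Poly_Mapping.keys q"
      using \<open>e \<in> _\<close> keys_mult[of p q] by blast
    then have "Poly_Mapping.keys a \<subseteq> {..<n}" "Poly_Mapping.keys b \<subseteq> {..<n}"
      using assms by (auto simp: laurent_ring_def)
    with ab(1) keys_add[of a b] show ?thesis by blast
  qed
  then show ?thesis by (simp add: laurent_ring_def)
qed

lemma laurent_sum [simp]:
  "(\<And>x. x \<in> A \<Longrightarrow> p x \<in> carrier (laurent_ring n)) \<Longrightarrow> sum p A \<in> carrier (laurent_ring n)"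
  by (induction A rule: infinite_finite_induct) auto

definition laurent_var_inv :: "nat \<Rightarrow> laurent"
  where "laurent_var_inv i = Poly_Mapping.single (Poly_Mapping.single i (- 1)) 1"

lemma laurent_var_closed [simp]: "i < n \<Longrightarrow> laurent_var i \<in> carrier (laurent_ring n)"
  by (auto simp: laurent_var_def laurent_ring_def)

lemma laurent_var_inv_closed [simp]: "i < n \<Longrightarrow> laurent_var_inv i \<in> carrier (laurent_ring n)"
  by (auto simp: laurent_var_inv_def laurent_ring_def)

lemma laurent_var_inverse [simp]:
  "laurent_var i * laurent_var_inv i = 1" "laurent_var_inv i * laurent_var i = 1"
  by (simp_all add: laurent_var_def laurent_var_inv_def mult_single single_add[symmetric])

lemma laurent_var_eq_iff [simp]: "laurent_var i = laurent_var j \<longleftrightarrow> i = j"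
proof
  assume "laurent_var i = laurent_var j"
  then have "Poly_Mapping.keys (laurent_var i) = Poly_Mapping.keys (laurent_var j)" by simp
  then have "Poly_Mapping.single i (1::int) = Poly_Mapping.single j 1"
    by (simp add: laurent_var_def)
  then have "Poly_Mapping.keys (Poly_Mapping.single i (1::int)) = Poly_Mapping.keys (Poly_Mapping.single j (1::int))"
    by simp
  then show "i = j" by simp
qed simp

lemma laurent_var_Units: "i < n \<Longrightarrow> laurent_var i \<in> Units (laurent_ring n)"
  unfolding Units_def by (auto intro!: exI[of _ "laurent_var_inv i"] bexI[of _ "laurent_var_inv i"])

lemma inv_laurent_var:
  assumes "i < n"
  shows "inv\<^bsub>laurent_ring n\<^esub> (laurent_var i) = laurent_var_inv i"
  unfolding m_inv_def
proof (rule the_equality)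
  fix y assume "y \<in> carrier (laurent_ring n) \<and> laurent_var i \<otimes>\<^bsub>laurent_ring n\<^esub> y = \<one>\<^bsub>laurent_ring n\<^esub> \<and>
    y \<otimes>\<^bsub>laurent_ring n\<^esub> laurent_var i = \<one>\<^bsub>laurent_ring n\<^esub>"
  then have "laurent_var i * y = 1" by simp
  then have "laurent_var_inv i * (laurent_var i * y) = laurent_var_inv i" by simp
  then show "y = laurent_var_inv i" by (simp flip: mult.assoc)
qed (use assms in simp)

text \<open>
  The ring homomorphisms \<open>\<Lambda>\<^sub>n \<rightarrow> \<Lambda>\<^sub>m\<close> that occur are the specialization of the variables of deleted
  components and the identity. The map \<open>lin g\<close> is the semilinear extension of a map \<open>g\<close> on a basis.
\<close>

locale laurent_hom =
  fixes \<theta> :: "laurent \<Rightarrow> laurent" and n m :: nat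
  assumes add: "\<theta> (p + q) = \<theta> p + \<theta> q"
    and mult: "\<theta> (p * q) = \<theta> p * \<theta> q"
    and one: "\<theta> 1 = 1"
    and closed: "p \<in> carrier (laurent_ring n) \<Longrightarrow> \<theta> p \<in> carrier (laurent_ring m)"
begin

lemma additive_hom: "Modules.additive \<theta>"
  by (simp add: Modules.additive_def add)

lemmas zero = additive.zero[OF additive_hom]
lemmas diff = additive.diff[OF additive_hom]

definition lin :: "('x \<Rightarrow> ('y \<Rightarrow>\<^sub>0 laurent)) \<Rightarrow> ('x \<Rightarrow>\<^sub>0 laurent) \<Rightarrow> ('y \<Rightarrow>\<^sub>0 laurent)"
  where "lin g = extend (\<lambda>a r. scale (\<theta> r) (g a))"

lemma additive_coefficient: "Modules.additive (\<lambda>r. scale (\<theta> r) v)"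
  by (rule additive_comp[OF additive_scale_left additive_hom])

lemma additive_lin: "Modules.additive (lin g)"
  unfolding lin_def by (rule additive_extend) (rule additive_coefficient)

lemma lin_single: "lin g (Poly_Mapping.single a r) = scale (\<theta> r) (g a)"
  unfolding lin_def by (rule extend_single) (simp add: zero)

lemma lin_scale: "lin g (scale r v) = scale (\<theta> r) (lin g v)"
  by (rule additive_eqI[where f = "\<lambda>v. lin g (scale r v)"])
    (simp_all add: additive_comp additive_lin additive_scale_right scale_single lin_single mult)

end

text \<open>
  Forgetting components of a link forgets their variables by setting them equal to 1. On exponent
  vectors this keeps the entries listed in \<open>is\<close>.
\<close>

definition restrict_exponent :: "nat list \<Rightarrow> (nat \<Rightarrow>\<^sub>0 int) \<Rightarrow> (nat \<Rightarrow>\<^sub>0 int)"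
  where "restrict_exponent is e = (\<Sum>j<length is. Poly_Mapping.single j (Poly_Mapping.lookup e (is ! j)))"

definition restrict_laurent :: "nat list \<Rightarrow> laurent \<Rightarrow> laurent"
  where "restrict_laurent is = extend (\<lambda>e. Poly_Mapping.single (restrict_exponent is e))"

lemma restrict_exponent_add: "restrict_exponent is (d + e) = restrict_exponent is d + restrict_exponent is e"
  by (simp add: restrict_exponent_def lookup_add single_add sum.distrib)

lemma keys_restrict_exponent: "Poly_Mapping.keys (restrict_exponent is e) \<subseteq> {..<length is}"
  by (auto simp: in_keys_iff restrict_exponent_def lookup_sum lookup_single when_def split: if_splits)

lemma restrict_laurent_single:
  "restrict_laurent is (Poly_Mapping.single e c) = Poly_Mapping.single (restrict_exponent is e) c"
  by (simp add: restrict_laurent_def extend_single)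

lemma laurent_hom_restrict: "laurent_hom (restrict_laurent is) n (length is)"
proof
  have add: "Modules.additive (restrict_laurent is)"
    unfolding restrict_laurent_def by (intro additive_extend additive_single)
  then show "restrict_laurent is (p + q) = restrict_laurent is p + restrict_laurent is q" for p q
    by (simp add: additive.add)
  \<comment> \<open>Multiplicativity holds on monomials and is then extended in one factor at a time.\<close>
  have 1: "restrict_laurent is (Poly_Mapping.single d a * Poly_Mapping.single e b)
      = restrict_laurent is (Poly_Mapping.single d a) * restrict_laurent is (Poly_Mapping.single e b)" for d e a b
    by (simp add: restrict_laurent_single mult_single restrict_exponent_add)
  have 2: "restrict_laurent is (Poly_Mapping.single d a * q)
      = restrict_laurent is (Poly_Mapping.single d a) * restrict_laurent is q" for d a q
    by (rule additive_eqI[where v = q])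
      (simp_all add: 1 additive_comp[OF add additive_times_left] additive_comp[OF additive_times_left add])
  show "restrict_laurent is (p * q) = restrict_laurent is p * restrict_laurent is q" for p q
    by (rule additive_eqI[where v = p])
      (simp_all add: 2 additive_comp[OF add additive_times_right] additive_comp[OF additive_times_right add])
  have "restrict_laurent is (Poly_Mapping.single 0 1) = Poly_Mapping.single (restrict_exponent is 0) 1"
    by (rule restrict_laurent_single)
  then show "restrict_laurent is 1 = 1"
    by (simp add: restrict_exponent_def)
  show "restrict_laurent is p \<in> carrier (laurent_ring (length is))" for p
    unfolding restrict_laurent_def extend_def
    using keys_restrict_exponent by (intro laurent_sum) (fastforce simp: laurent_ring_def)
qed

lemma restrict_laurent_kept:
  assumes "distinct is" "j < length is"
  shows "restrict_laurent is (laurent_var (is ! j)) = laurent_var j"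
proof -
  have "restrict_exponent is (Poly_Mapping.single (is ! j) 1)
      = (\<Sum>k<length is. if k = j then Poly_Mapping.single j 1 else 0)"
    unfolding restrict_exponent_def using assms
    by (intro sum.cong) (auto simp: lookup_single when_def nth_eq_iff_index_eq)
  also have "\<dots> = Poly_Mapping.single j 1"
    using assms by simp
  finally show ?thesis
    by (simp add: laurent_var_def restrict_laurent_single)
qed

lemma restrict_laurent_dropped:
  assumes "i \<notin> set is"
  shows "restrict_laurent is (laurent_var i) = 1"
proof -
  have "restrict_exponent is (Poly_Mapping.single i 1) = 0"
    unfolding restrict_exponent_def using assms
    by (intro sum.neutral) (auto simp: lookup_single when_def)
  then show ?thesis
    by (simp add: laurent_var_def restrict_laurent_single)
qed

section \<open>Coset arithmetic in the Alexander module\<close>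

text \<open>The linear functional on the free module of arcs that induces the Crowell map.\<close>

definition phi :: "diagram \<Rightarrow> (arc \<Rightarrow>\<^sub>0 laurent) \<Rightarrow> laurent"
  where "phi D = extend (\<lambda>a r. r * (laurent_var (arc_index D a) - 1))"

lemma additive_phi: "Modules.additive (phi D)"
  unfolding phi_def by (intro additive_extend additive_times_right)

lemma phi_single: "phi D (Poly_Mapping.single a r) = r * (laurent_var (arc_index D a) - 1)"
  unfolding phi_def by (rule extend_single) simp

lemma phi_scale: "phi D (scale r v) = r * phi D v"
  by (rule additive_eqI[where v = v])
   (simp_all add: additive_comp additive_phi additive_scale_right additive_comp[OF additive_times_left additive_phi]
     scale_single phi_single mult.assoc)

lemmas phi_add = additive.add[OF additive_phi]
  and phi_diff = additive.diff[OF additive_phi]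
  and phi_zero = additive.zero[OF additive_phi]

lemma rho_extend: "rho D = extend (\<lambda>c r. scale r (crossing_relation D c))"
  by (simp add: fun_eq_iff rho_def extend_def)

lemma additive_rho: "Modules.additive (rho D)"
  unfolding rho_extend by (intro additive_extend additive_scale_left)

lemma rho_single: "rho D (Poly_Mapping.single c r) = scale r (crossing_relation D c)"
  unfolding rho_extend by (rule extend_single) simp

lemma rho_scale: "rho D (scale r w) = scale r (rho D w)"
  by (rule additive_eqI[where v = w])
   (simp_all add: additive_comp[OF additive_rho additive_scale_right] additive_comp[OF additive_scale_right additive_rho]
     scale_single rho_single)

lemma free_module_carrier:
  "v \<in> carrier (free_module n X) \<longleftrightarrow>
    Poly_Mapping.keys v \<subseteq> X \<and> (\<forall>x. Poly_Mapping.lookup v x \<in> carrier (laurent_ring n))"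
  by (simp add: free_module_def)

lemma free_module_zero: "0 \<in> carrier (free_module n X)"
  by (simp add: free_module_carrier)

lemma free_module_add:
  "v \<in> carrier (free_module n X) \<Longrightarrow> w \<in> carrier (free_module n X) \<Longrightarrow> v + w \<in> carrier (free_module n X)"
  using keys_add[of v w] by (auto simp: free_module_carrier lookup_add)

lemma free_module_scale:
  "r \<in> carrier (laurent_ring n) \<Longrightarrow> v \<in> carrier (free_module n X) \<Longrightarrow> scale r v \<in> carrier (free_module n X)"
  using keys_scale_subset[of r v] by (auto simp: free_module_carrier lookup_scale)

lemma free_module_uminus: "v \<in> carrier (free_module n X) \<Longrightarrow> - v \<in> carrier (free_module n X)"
  by (auto simp: free_module_carrier in_keys_iff)

lemma free_module_diff:
  "v \<in> carrier (free_module n X) \<Longrightarrow> w \<in> carrier (free_module n X) \<Longrightarrow> v - w \<in> carrier (free_module n X)"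
  using free_module_add[of v n X "- w"] free_module_uminus[of w] by simp

lemma free_module_single:
  "x \<in> X \<Longrightarrow> r \<in> carrier (laurent_ring n) \<Longrightarrow> Poly_Mapping.single x r \<in> carrier (free_module n X)"
  by (auto simp: free_module_carrier lookup_single when_def)

lemma free_module_sum:
  "(\<And>x. x \<in> A \<Longrightarrow> v x \<in> carrier (free_module n X)) \<Longrightarrow> sum v A \<in> carrier (free_module n X)"
  by (induction A rule: infinite_finite_induct) (auto simp: free_module_zero free_module_add)

lemma (in laurent_hom) lin_carrier:
  assumes "v \<in> carrier (free_module n X)" "\<And>a. a \<in> X \<Longrightarrow> g a \<in> carrier (free_module m Y)"
  shows "lin g v \<in> carrier (free_module m Y)"
  unfolding lin_def extend_def
  using assms closed by (intro free_module_sum free_module_scale) (auto simp: free_module_carrier)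

lemma (in laurent_hom) phi_lin:
  assumes "v \<in> carrier (free_module n (arcs D))"
    and "\<And>a. a \<in> arcs D \<Longrightarrow> phi E (g a) = \<theta> (laurent_var (arc_index D a) - 1)"
  shows "phi E (lin g v) = \<theta> (phi D v)"
proof -
  have "phi E (lin g v) = (\<Sum>a\<in>Poly_Mapping.keys v. phi E (scale (\<theta> (Poly_Mapping.lookup v a)) (g a)))"
    unfolding lin_def extend_def by (rule additive.sum[OF additive_phi])
  also have "\<dots> = (\<Sum>a\<in>Poly_Mapping.keys v. \<theta> (Poly_Mapping.lookup v a * (laurent_var (arc_index D a) - 1)))"
    using assms by (intro sum.cong) (auto simp: phi_scale mult free_module_carrier)
  also have "\<dots> = \<theta> (phi D v)"
    unfolding phi_def extend_def by (rule additive.sum[OF additive_hom, symmetric])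
  finally show ?thesis .
qed

lemma relations_zero: "0 \<in> relations D"
  unfolding relations_def using additive.zero[OF additive_rho, of D] free_module_zero
  by (metis imageI)

lemma relations_add: "v \<in> relations D \<Longrightarrow> w \<in> relations D \<Longrightarrow> v + w \<in> relations D"
  unfolding relations_def using additive.add[OF additive_rho, of D] free_module_add
  by (smt (verit, ccfv_SIG) imageE image_eqI)

lemma relations_scale:
  "r \<in> carrier (laurent_ring (length D)) \<Longrightarrow> v \<in> relations D \<Longrightarrow> scale r v \<in> relations D"
  unfolding relations_def using rho_scale free_module_scale
  by (smt (verit, ccfv_SIG) imageE image_eqI)

lemma relations_uminus: "v \<in> relations D \<Longrightarrow> - v \<in> relations D"
  using relations_scale[of "- 1" D v] by simp

lemma relations_diff: "v \<in> relations D \<Longrightarrow> w \<in> relations D \<Longrightarrow> v - w \<in> relations D"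
  using relations_add[of v D "- w"] relations_uminus[of w D] by simp

lemma relations_sum: "(\<And>x. x \<in> A \<Longrightarrow> v x \<in> relations D) \<Longrightarrow> sum v A \<in> relations D"
  by (induction A rule: infinite_finite_induct) (auto simp: relations_zero relations_add)

lemma crossing_relation_in_relations: "c \<in> crossings D \<Longrightarrow> crossing_relation D c \<in> relations D"
  unfolding relations_def using rho_single[of D c 1] free_module_single[of c "crossings D" 1]
  by (metis image_eqI laurent_one scaling.scale_one)

text \<open>
  The universal property of the cokernel in the form used below: only the multiples of the defining relations have to
  be checked.
\<close>

lemma additive_maps_relations:
  assumes h: "Modules.additive h"
    and "\<And>c r. c \<in> crossings D \<Longrightarrow> r \<in> carrier (laurent_ring (length D)) \<Longrightarrow>
      h (scale r (crossing_relation D c)) \<in> relations E"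
    and "v \<in> relations D"
  shows "h v \<in> relations E"
proof -
  obtain w where w: "w \<in> carrier (free_module (length D) (crossings D))" "v = rho D w"
    using assms(3) unfolding relations_def by blast
  have "h v = (\<Sum>c\<in>Poly_Mapping.keys w. h (scale (Poly_Mapping.lookup w c) (crossing_relation D c)))"
    unfolding w(2) rho_def by (rule additive.sum[OF h])
  also have "\<dots> \<in> relations E"
    using w(1) assms(2) by (intro relations_sum) (auto simp: free_module_carrier)
  finally show ?thesis .
qed

lemma gamma_eq: "gamma D v = {n + v | n. n \<in> relations D}"
  by (auto simp: gamma_def a_r_coset_def r_coset_def free_module_def)

lemma gamma_eq_iff: "gamma D v = gamma D w \<longleftrightarrow> v - w \<in> relations D"
proof
  assume "gamma D v = gamma D w"
  then have "0 + v \<in> gamma D w"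
    using relations_zero[of D] by (auto simp: gamma_eq)
  then show "v - w \<in> relations D" by (auto simp: gamma_eq)
next
  assume *: "v - w \<in> relations D"
  have "n + v \<in> gamma D w" "n + w \<in> gamma D v" if "n \<in> relations D" for n
    using that relations_add[OF that *] relations_diff[OF that *]
    by (auto simp: gamma_eq intro: exI[of _ "n + v - w"] exI[of _ "n + w - v"] simp: algebra_simps)
  then show "gamma D v = gamma D w" by (auto simp: gamma_eq)
qed

lemma gamma_add: "gamma D v \<oplus>\<^bsub>alexander_module D\<^esub> gamma D w = gamma D (v + w)"
proof -
  have "gamma D v \<oplus>\<^bsub>alexander_module D\<^esub> gamma D w = {x + y | x y. x \<in> gamma D v \<and> y \<in> gamma D w}"
    by (auto simp: alexander_module_def quotient_module_def set_add_def set_mult_def free_module_def)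
  also have "\<dots> = gamma D (v + w)"
  proof (intro equalityI subsetI; clarify)
    fix x y assume "x \<in> gamma D v" "y \<in> gamma D w"
    then obtain a b where "a \<in> relations D" "b \<in> relations D" "x = a + v" "y = b + w"
      by (auto simp: gamma_eq)
    then show "x + y \<in> gamma D (v + w)"
      using relations_add[of a D b] by (auto simp: gamma_eq intro!: exI[of _ "a + b"])
  next
    fix x assume "x \<in> gamma D (v + w)"
    then obtain a where "a \<in> relations D" "x = (a + v) + (0 + w)"
      by (auto simp: gamma_eq add.assoc)
    then show "\<exists>x' y. x = x' + y \<and> x' \<in> gamma D v \<and> y \<in> gamma D w"
      using relations_zero[of D] unfolding gamma_eq by blast
  qed
  finally show ?thesis .
qed

lemma gamma_scale:
  assumes r: "r \<in> carrier (laurent_ring (length D))"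
  shows "r \<odot>\<^bsub>alexander_module D\<^esub> gamma D v = gamma D (scale r v)"
proof -
  have "r \<odot>\<^bsub>alexander_module D\<^esub> gamma D v = (\<Union>x\<in>gamma D v. gamma D (scale r x))"
    by (simp add: alexander_module_def quotient_module_def gamma_def free_module_def)
  also have "gamma D (scale r x) = gamma D (scale r v)" if "x \<in> gamma D v" for x
  proof -
    from that have "x - v \<in> relations D"
      by (auto simp: gamma_eq)
    then show ?thesis
      using relations_scale[OF r] by (auto simp: gamma_eq_iff scaling.scale_right_diff_distrib[symmetric])
  qed
  then have "(\<Union>x\<in>gamma D v. gamma D (scale r x)) = (\<Union>x\<in>gamma D v. gamma D (scale r v))"
    by auto
  also have "\<dots> = gamma D (scale r v)"
    using relations_zero[of D] by (auto simp: gamma_eq)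
  finally show ?thesis .
qed

lemma carrier_alexander_module: "carrier (alexander_module D) = gamma D ` carrier (arc_module D)"
  by (auto simp: alexander_module_def quotient_module_def gamma_def A_RCOSETS_def RCOSETS_def a_r_coset_def free_module_def)

lemma zero_alexander_module: "\<zero>\<^bsub>alexander_module D\<^esub> = gamma D 0"
  by (auto simp: alexander_module_def quotient_module_def gamma_eq)

lemma gamma_uminus:
  assumes "v \<in> carrier (arc_module D)"
  shows "\<ominus>\<^bsub>alexander_module D\<^esub> gamma D v = gamma D (- v)"
  unfolding a_inv_def m_inv_def
proof (rule the_equality)
  show "gamma D (- v) \<in> carrier (add_monoid (alexander_module D)) \<and>
    gamma D v \<otimes>\<^bsub>add_monoid (alexander_module D)\<^esub> gamma D (- v) = \<one>\<^bsub>add_monoid (alexander_module D)\<^esub> \<and>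
    gamma D (- v) \<otimes>\<^bsub>add_monoid (alexander_module D)\<^esub> gamma D v = \<one>\<^bsub>add_monoid (alexander_module D)\<^esub>"
    using assms free_module_uminus by (auto simp: carrier_alexander_module gamma_add zero_alexander_module)
next
  fix y assume y: "y \<in> carrier (add_monoid (alexander_module D)) \<and>
    gamma D v \<otimes>\<^bsub>add_monoid (alexander_module D)\<^esub> y = \<one>\<^bsub>add_monoid (alexander_module D)\<^esub> \<and>
    y \<otimes>\<^bsub>add_monoid (alexander_module D)\<^esub> gamma D v = \<one>\<^bsub>add_monoid (alexander_module D)\<^esub>"
  then obtain w where "y = gamma D w"
    by (auto simp: carrier_alexander_module)
  with y show "y = gamma D (- v)"
    by (simp add: gamma_add zero_alexander_module gamma_eq_iff add.commute)
qed

lemma gamma_diff: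
  assumes "w \<in> carrier (arc_module D)"
  shows "gamma D v \<ominus>\<^bsub>alexander_module D\<^esub> gamma D w = gamma D (v - w)"
  by (simp add: a_minus_def gamma_uminus[OF assms] gamma_add)

text \<open>
  The map of cokernels induced by \<open>h\<close>. A representative is chosen with \<open>SOME\<close>; the choice does not
  matter as soon as \<open>h\<close> is additive and preserves relations.
\<close>

definition induced :: "diagram \<Rightarrow> diagram \<Rightarrow> ((arc \<Rightarrow>\<^sub>0 laurent) \<Rightarrow> (arc \<Rightarrow>\<^sub>0 laurent)) \<Rightarrow>
    alexander_element \<Rightarrow> alexander_element"
  where "induced D E h X = gamma E (h (SOME v. v \<in> X))"

lemma induced_gamma:
  assumes "Modules.additive h" "\<And>v. v \<in> relations D \<Longrightarrow> h v \<in> relations E"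
  shows "induced D E h (gamma D v) = gamma E (h v)"
proof -
  define w where "w = (SOME w. w \<in> gamma D v)"
  have "v \<in> gamma D v"
    using relations_zero[of D] by (auto simp: gamma_eq)
  then have "w \<in> gamma D v"
    unfolding w_def by (rule someI)
  then have "w - v \<in> relations D"
    by (auto simp: gamma_eq)
  then have "h w - h v \<in> relations E"
    using assms by (simp flip: additive.diff)
  then show ?thesis
    by (simp add: induced_def w_def gamma_eq_iff)
qed

section \<open>Simple closed curves cut at finitely many points\<close>

text \<open>
  A curve of period 1 without self-intersections. It is studied through its parameter, since the
  real line is easier to cut than its image.
\<close>

locale closed_curve =
  fixes K :: "real \<Rightarrow> 'p::t2_space"
  assumes continuous: "continuous_on UNIV K"
    and periodic: "K (s + 1) = K s"
    and simple: "K s = K t \<Longrightarrow> s - t \<in> \<int>"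
begin

lemma periodic_nat: "K (s + of_nat n) = K s"
proof (induction n)
  case (Suc n)
  then show ?case
    using periodic[of "s + of_nat n"] by (simp add: algebra_simps)
qed simp

lemma periodic_Ints:
  assumes "k \<in> \<int>" shows "K (s + k) = K s"
proof -
  obtain z :: int where k: "k = of_int z"
    using assms Ints_cases by blast
  show ?thesis
  proof (cases "z \<ge> 0")
    case True
    then show ?thesis using periodic_nat[of s "nat z"] k by simp
  next
    case False
    then show ?thesis using periodic_nat[of "s + k" "nat (- z)"] k by simp
  qed
qed

lemma eq_iff: "K s = K t \<longleftrightarrow> s - t \<in> \<int>"
  using simple periodic_Ints[of "s - t" t] by auto

lemma frac_eq: "K (frac s) = K s"
  unfolding eq_iff by (simp add: frac_def)

lemma finite_preimage_near:
  assumes "finite W"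
  shows "\<exists>e>0. \<forall>t. t \<noteq> s \<and> \<bar>t - s\<bar> < e \<longrightarrow> K t \<notin> W"
proof -
  define B where "B = {s - 1/2<..<s + 1/2}"
  have "inj_on K B"
  proof (rule inj_onI)
    fix t t' assume t: "t \<in> B" "t' \<in> B" "K t = K t'"
    then obtain z :: int where z: "t - t' = of_int z"
      using simple Ints_cases by blast
    have "\<bar>t - t'\<bar> < 1" using t(1,2) by (auto simp: B_def abs_if)
    then have "z = 0" using z by linarith
    then show "t = t'" using z by simp
  qed
  then have "finite (K -` W \<inter> B)"
    using assms finite_vimage_IntI by blast
  then obtain d where d: "d > 0" "\<forall>x\<in>K -` W \<inter> B. x \<noteq> s \<longrightarrow> d \<le> dist s x"
    using finite_set_avoid by blast
  have "K t \<notin> W" if "t \<noteq> s" "\<bar>t - s\<bar> < min d (1/2)" for t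
  proof
    assume "K t \<in> W"
    moreover have "t \<in> B" using that(2) by (auto simp: B_def abs_if split: if_splits)
    ultimately have "d \<le> dist s t" using d(2) that(1) by auto
    with that(2) show False by (simp add: dist_real_def abs_minus_commute)
  qed
  then show ?thesis
    using d(1) by (intro exI[of _ "min d (1/2)"]) auto
qed

lemma interval_in_component:
  assumes "connected J" "J \<noteq> {}" "\<And>t. t \<in> J \<Longrightarrow> K t \<notin> W"
  obtains c where "c \<in> components (range K - W)" "K ` J \<subseteq> c"
proof -
  have "connected (K ` J)"
    using continuous assms(1) connected_continuous_image continuous_on_subset by blast
  moreover have "K ` J \<subseteq> range K - W" "K ` J \<noteq> {}"
    using assms by auto
  moreover from this have "range K - W \<noteq> {}" by blast
  ultimately show ?thesis
    using that exists_component_superset[of "K ` J" "range K - W"] by blast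
qed

text \<open>
  The components of the curve minus \<open>W\<close> that contain all points shortly before, respectively after, the
  parameter \<open>s\<close>. They exist also when the point with parameter \<open>s\<close> belongs to \<open>W\<close>; outside of \<open>W\<close> they coincide.
\<close>

definition arc_before :: "'p set \<Rightarrow> real \<Rightarrow> 'p set"
  where "arc_before W s = (THE c. c \<in> components (range K - W) \<and> (\<exists>e>0. K ` {s - e<..<s} \<subseteq> c))"

definition arc_after :: "'p set \<Rightarrow> real \<Rightarrow> 'p set"
  where "arc_after W s = (THE c. c \<in> components (range K - W) \<and> (\<exists>e>0. K ` {s<..<s + e} \<subseteq> c))"

lemma arc_before_eqI:
  assumes "c \<in> components (range K - W)" "e > 0" "K ` {s - e<..<s} \<subseteq> c"
  shows "arc_before W s = c"
  unfolding arc_before_def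
proof (rule the_equality)
  fix c' assume c': "c' \<in> components (range K - W) \<and> (\<exists>e>0. K ` {s - e<..<s} \<subseteq> c')"
  then obtain e' where e': "e' > 0" "K ` {s - e'<..<s} \<subseteq> c'" by blast
  define t where "t = s - min e e' / 2"
  have "t \<in> {s - e<..<s}" "t \<in> {s - e'<..<s}"
    using assms(2) e'(1) by (auto simp: t_def)
  then have "K t \<in> c" "K t \<in> c'"
    using assms(3) e'(2) by blast+
  then show "c' = c"
    using c' assms(1) components_eq by blast
qed (use assms in blast)

lemma arc_after_eqI:
  assumes "c \<in> components (range K - W)" "e > 0" "K ` {s<..<s + e} \<subseteq> c"
  shows "arc_after W s = c"
  unfolding arc_after_def
proof (rule the_equality)
  fix c' assume c': "c' \<in> components (range K - W) \<and> (\<exists>e>0. K ` {s<..<s + e} \<subseteq> c')"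
  then obtain e' where e': "e' > 0" "K ` {s<..<s + e'} \<subseteq> c'" by blast
  define t where "t = s + min e e' / 2"
  have "t \<in> {s<..<s + e}" "t \<in> {s<..<s + e'}"
    using assms(2) e'(1) by (auto simp: t_def)
  then have "K t \<in> c" "K t \<in> c'"
    using assms(3) e'(2) by blast+
  then show "c' = c"
    using c' assms(1) components_eq by blast
qed (use assms in blast)

lemma arc_before_after:
  assumes "finite W"
  obtains e where "e > 0" "\<And>t. t \<noteq> s \<Longrightarrow> \<bar>t - s\<bar> < e \<Longrightarrow> K t \<notin> W"
    "arc_before W s \<in> components (range K - W)" "K ` {s - e<..<s} \<subseteq> arc_before W s"
    "arc_after W s \<in> components (range K - W)" "K ` {s<..<s + e} \<subseteq> arc_after W s"
proof -
  obtain e where e: "e > 0" "\<And>t. t \<noteq> s \<Longrightarrow> \<bar>t - s\<bar> < e \<Longrightarrow> K t \<notin> W"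
    using finite_preimage_near[OF assms] by blast
  have ne: "{s - e<..<s} \<noteq> {}" "{s<..<s + e} \<noteq> {}"
    using e(1) by auto
  have before: "K t \<notin> W" if "t \<in> {s - e<..<s}" for t
    using that by (intro e(2)) auto
  have after: "K t \<notin> W" if "t \<in> {s<..<s + e}" for t
    using that by (intro e(2)) auto
  obtain c where c: "c \<in> components (range K - W)" "K ` {s - e<..<s} \<subseteq> c"
    using interval_in_component[OF connected_Ioo ne(1) before] .
  obtain c' where c': "c' \<in> components (range K - W)" "K ` {s<..<s + e} \<subseteq> c'"
    using interval_in_component[OF connected_Ioo ne(2) after] .
  show ?thesis
    using that[OF e] c c' arc_before_eqI[OF c(1) e(1) c(2)] arc_after_eqI[OF c'(1) e(1) c'(2)] by simp
qed

lemma arc_through: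
  assumes "finite W" "K s \<notin> W"
  shows "\<exists>e>0. K ` {s - e<..<s + e} \<subseteq> arc_before W s" "arc_after W s = arc_before W s"
    "arc_before W s \<in> components (range K - W)" "K s \<in> arc_before W s"
proof -
  obtain e where e: "e > 0" "\<And>t. t \<noteq> s \<Longrightarrow> \<bar>t - s\<bar> < e \<Longrightarrow> K t \<notin> W"
    using finite_preimage_near[OF assms(1)] by blast
  then have "K t \<notin> W" if "t \<in> {s - e<..<s + e}" for t
    using that assms(2) by (cases "t = s") (auto simp: abs_if)
  moreover have "{s - e<..<s + e} \<noteq> {}" using e(1) by auto
  ultimately obtain c where c: "c \<in> components (range K - W)" "K ` {s - e<..<s + e} \<subseteq> c"
    using interval_in_component[of "{s - e<..<s + e}" W] by (metis connected_Ioo)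
  have "arc_before W s = c"
    using c e(1) by (intro arc_before_eqI[of c W e]) auto
  moreover have "arc_after W s = c"
    using c e(1) by (intro arc_after_eqI[of c W e]) auto
  ultimately show "\<exists>e>0. K ` {s - e<..<s + e} \<subseteq> arc_before W s" "arc_after W s = arc_before W s"
    "arc_before W s \<in> components (range K - W)" "K s \<in> arc_before W s"
    using c e(1) by auto
qed

lemma arc_of_point:
  assumes "finite W" "c \<in> components (range K - W)" "K s \<in> c"
  shows "arc_before W s = c"
proof -
  have "K s \<notin> W" using assms(2,3) in_components_subset by blast
  from arc_through[OF assms(1) this] show ?thesis
    using assms(2,3) components_eq by blast
qed

lemma arc_before_shift:
  assumes "finite W" "K s = K t"
  shows "arc_before W s = arc_before W t"
proof -
  obtain e where e: "e > 0" "arc_before W s \<in> components (range K - W)"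
    "K ` {s - e<..<s} \<subseteq> arc_before W s"
    using arc_before_after[OF assms(1), of s] by metis
  have "K u \<in> arc_before W s" if "u \<in> {t - e<..<t}" for u
  proof -
    have "s - t \<in> \<int>" using assms(2) simple by blast
    then have "K (u + (s - t)) = K u" by (rule periodic_Ints)
    moreover have "u + (s - t) \<in> {s - e<..<s}" using that by auto
    ultimately show ?thesis using e(3) by (metis image_subset_iff)
  qed
  then show ?thesis
    using arc_before_eqI[OF e(2,1)] by (metis image_subset_iff)
qed

lemma arc_after_shift:
  assumes "finite W" "K s = K t"
  shows "arc_after W s = arc_after W t"
proof -
  obtain e where e: "e > 0" "arc_after W s \<in> components (range K - W)"
    "K ` {s<..<s + e} \<subseteq> arc_after W s"
    using arc_before_after[OF assms(1), of s] by metis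
  have "K u \<in> arc_after W s" if "u \<in> {t<..<t + e}" for u
  proof -
    have "s - t \<in> \<int>" using assms(2) simple by blast
    then have "K (u + (s - t)) = K u" by (rule periodic_Ints)
    moreover have "u + (s - t) \<in> {s<..<s + e}" using that by auto
    ultimately show ?thesis using e(3) by (metis image_subset_iff)
  qed
  then show ?thesis
    using arc_after_eqI[OF e(2,1)] by (metis image_subset_iff)
qed

text \<open>
  The parametrization is a quotient map onto its image: the complement of \<open>T\<close> is the
  image of a closed subset of the period \<open>[0, 1]\<close>, hence compact.
\<close>

lemma open_image:
  assumes "T \<subseteq> range K" "open (K -` T)"
  obtains G where "open G" "T = range K \<inter> G"
proof -
  have "range K - T = K ` ({0..1} - K -` T)"
  proof (intro equalityI subsetI)
    fix x assume "x \<in> range K - T"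
    then obtain s where s: "x = K (frac s)" "x \<notin> T" using frac_eq by auto
    have "frac s \<in> {0..1}" using frac_lt_1[of s] by (simp add: less_imp_le)
    with s show "x \<in> K ` ({0..1} - K -` T)" by blast
  qed auto
  moreover have "compact (K ` ({0..1} - K -` T))"
    using assms(2) continuous continuous_on_subset
    by (intro compact_continuous_image compact_diff) (auto intro: continuous_on_subset)
  ultimately have "open (- (range K - T))"
    using compact_imp_closed by (metis open_Compl)
  then show ?thesis
    using that assms(1) by blast
qed

text \<open>
  By the hypothesis on \<open>W - U\<close>, the value of \<open>h\<close> at the arc just before \<open>s\<close> is a locally constant
  function of \<open>s\<close> wherever the curve avoids \<open>U\<close>. Its level sets are therefore relatively open in
  the curve minus \<open>U\<close>, and the connected set \<open>b\<close> meets only one of them.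
\<close>

lemma gluing:
  assumes W: "finite W" "U \<subseteq> W"
    and glue: "\<And>s. K s \<in> W - U \<Longrightarrow> h (arc_before W s) = h (arc_after W s)"
    and b: "b \<in> components (range K - U)"
    and a: "a \<in> components (range K - W)" "a \<subseteq> b"
    and a': "a' \<in> components (range K - W)" "a' \<subseteq> b"
  shows "h a = h a'"
proof (rule ccontr)
  assume neq: "h a \<noteq> h a'"
  define H where "H s = h (arc_before W s)" for s
  have local: "\<exists>e>0. \<forall>t. \<bar>t - s\<bar> < e \<longrightarrow> K t \<notin> U \<and> H t = H s" if s: "K s \<notin> U" for s
  proof -
    obtain e where e: "e > 0" "\<And>t. t \<noteq> s \<Longrightarrow> \<bar>t - s\<bar> < e \<Longrightarrow> K t \<notin> W"
      "arc_before W s \<in> components (range K - W)" "K ` {s - e<..<s} \<subseteq> arc_before W s"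
      "arc_after W s \<in> components (range K - W)" "K ` {s<..<s + e} \<subseteq> arc_after W s"
      using arc_before_after[OF W(1), of s] by metis
    have "H t = H s" if t: "\<bar>t - s\<bar> < e" for t
    proof -
      consider "t = s" | "t \<in> {s - e<..<s}" | "t \<in> {s<..<s + e}"
        using t by (cases t s rule: linorder_cases) (auto simp: abs_if)
      then show ?thesis
      proof cases
        case 2
        then have "K t \<in> arc_before W s" using e(4) by blast
        then show ?thesis using arc_of_point[OF W(1) e(3)] by (simp add: H_def)
      next
        case 3
        then have "K t \<in> arc_after W s" using e(6) by blast
        then have "H t = h (arc_after W s)"
          using arc_of_point[OF W(1) e(5)] by (simp add: H_def)
        also have "\<dots> = H s"
          using glue[of s] arc_through(2)[OF W(1), of s] s by (cases "K s \<in> W") (auto simp: H_def)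
        finally show ?thesis .
      qed simp
    qed
    moreover have "K t \<notin> U" if "\<bar>t - s\<bar> < e" for t
      using that e(2) s W(2) by (cases "t = s") auto
    ultimately show ?thesis using e(1) by blast
  qed
  have shift: "H s = H t" if "K s = K t" for s t
    using arc_before_shift[OF W(1) that] by (simp add: H_def)
  \<comment> \<open>Applied to the level set of \<open>h a\<close> and to its complement, this yields a separation of \<open>b\<close>.\<close>
  have opn: "\<exists>G. open G \<and> K ` {s. K s \<notin> U \<and> P (H s)} = range K \<inter> G" for P
  proof -
    let ?A = "{s. K s \<notin> U \<and> P (H s)}"
    have "K -` (K ` ?A) = ?A"
    proof (intro equalityI subsetI)
      fix s assume "s \<in> K -` (K ` ?A)"
      then obtain t where "K s = K t" "K t \<notin> U" "P (H t)" by blast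
      then show "s \<in> ?A" using shift[of s t] by simp
    qed auto
    moreover have "open ?A"
      unfolding open_dist dist_real_def
    proof
      fix s assume s: "s \<in> ?A"
      then obtain e where e: "e > 0" "\<forall>t. \<bar>t - s\<bar> < e \<longrightarrow> K t \<notin> U \<and> H t = H s"
        using local[of s] by blast
      have "y \<in> ?A" if "\<bar>y - s\<bar> < e" for y
      proof -
        have "K y \<notin> U" "H y = H s" using e(2) that by blast+
        with s show ?thesis by simp
      qed
      with e(1) show "\<exists>e>0. \<forall>y. \<bar>y - s\<bar> < e \<longrightarrow> y \<in> ?A" by blast
    qed
    ultimately have "open (K -` (K ` ?A))" by simp
    moreover have "K ` ?A \<subseteq> range K" by blast
    ultimately show ?thesis
      using open_image[of "K ` ?A"] by metis
  qed
  obtain G where G: "open G" "K ` {s. K s \<notin> U \<and> H s = h a} = range K \<inter> G"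
    using opn[of "\<lambda>v. v = h a"] by blast
  obtain G' where G': "open G'" "K ` {s. K s \<notin> U \<and> H s \<noteq> h a} = range K \<inter> G'"
    using opn[of "\<lambda>v. v \<noteq> h a"] by blast
  have b_sub: "b \<subseteq> range K - U" using b in_components_subset by blast
  have "connected b" using b in_components_connected by blast
  moreover have "b \<subseteq> G \<union> G'"
  proof
    fix x assume "x \<in> b"
    then obtain s where s: "x = K s" "K s \<notin> U" using b_sub by blast
    then have "x \<in> range K \<inter> G \<or> x \<in> range K \<inter> G'"
      unfolding G(2)[symmetric] G'(2)[symmetric] by blast
    then show "x \<in> G \<union> G'" by blast
  qed
  moreover have "G \<inter> G' \<inter> b = {}"
  proof -
    have False if x: "x \<in> G" "x \<in> G'" "x \<in> b" for x
    proof -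
      have "x \<in> range K" using x b_sub by blast
      then have "x \<in> K ` {s. K s \<notin> U \<and> H s = h a}" "x \<in> K ` {s. K s \<notin> U \<and> H s \<noteq> h a}"
        using G(2) G'(2) x by auto
      then obtain s t where "K s = K t" "H s = h a" "H t \<noteq> h a" by blast
      then show False using shift[of s t] by simp
    qed
    then show ?thesis by blast
  qed
  ultimately have disj: "G \<inter> b = {} \<or> G' \<inter> b = {}"
    using connectedD[of b G G'] G(1) G'(1) by blast
  have point: "\<exists>s. K s \<in> c \<and> K s \<notin> U \<and> H s = h c" if c: "c \<in> components (range K - W)" for c
  proof -
    obtain s where s: "K s \<in> c"
      using in_components_nonempty[OF c] in_components_subset[OF c] by blast
    moreover have "K s \<notin> U" using s in_components_subset[OF c] W(2) by blast
    ultimately show ?thesis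
      using arc_of_point[OF W(1) c s] by (auto simp: H_def)
  qed
  obtain s s' where s: "K s \<in> a" "K s \<notin> U" "H s = h a" "K s' \<in> a'" "K s' \<notin> U" "H s' = h a'"
    using point[OF a(1)] point[OF a'(1)] by blast
  then have "K s \<in> G" "K s' \<in> G'"
    using G(2) G'(2) neq by auto
  with s a(2) a'(2) disj show False by blast
qed

lemma component_refines:
  assumes "U \<subseteq> W" "a \<in> components (range K - W)"
  obtains b where "b \<in> components (range K - U)" "a \<subseteq> b"
proof -
  have "connected a" "a \<noteq> {}" "a \<subseteq> range K - U"
    using assms in_components_connected in_components_nonempty in_components_subset by blast+
  moreover from this have "range K - U \<noteq> {}" by blast
  ultimately show ?thesis
    using that exists_component_superset[of a "range K - U"] by blast
qed

lemma arc_before_mono: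
  assumes "finite W" "U \<subseteq> W" shows "arc_before W s \<subseteq> arc_before U s"
proof -
  obtain e where e: "e > 0" "arc_before W s \<in> components (range K - W)" "K ` {s - e<..<s} \<subseteq> arc_before W s"
    using arc_before_after[OF assms(1), of s] by metis
  obtain b where b: "b \<in> components (range K - U)" "arc_before W s \<subseteq> b"
    using component_refines[OF assms(2) e(2)] .
  then have "arc_before U s = b"
    using e by (intro arc_before_eqI[of b U e]) auto
  with b show ?thesis by simp
qed

lemma arc_after_mono:
  assumes "finite W" "U \<subseteq> W" shows "arc_after W s \<subseteq> arc_after U s"
proof -
  obtain e where e: "e > 0" "arc_after W s \<in> components (range K - W)" "K ` {s<..<s + e} \<subseteq> arc_after W s"
    using arc_before_after[OF assms(1), of s] by metis
  obtain b where b: "b \<in> components (range K - U)" "arc_after W s \<subseteq> b"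
    using component_refines[OF assms(2) e(2)] .
  then have "arc_after U s = b"
    using e by (intro arc_after_eqI[of b U e]) auto
  with b show ?thesis by simp
qed

lemma component_contains:
  assumes "finite W" "U \<subseteq> W" "b \<in> components (range K - U)"
  obtains a where "a \<in> components (range K - W)" "a \<subseteq> b"
proof -
  have fU: "finite U" using assms finite_subset by blast
  obtain s where s: "K s \<in> b"
    using in_components_nonempty[OF assms(3)] in_components_subset[OF assms(3)] by blast
  then have "K s \<notin> U" using in_components_subset[OF assms(3)] by blast
  then obtain e where e: "e > 0" "K ` {s - e<..<s + e} \<subseteq> b"
    using arc_through(1)[OF fU] arc_of_point[OF fU assms(3) s] by metis
  obtain e' where e': "e' > 0"
    "arc_before W s \<in> components (range K - W)" "K ` {s - e'<..<s} \<subseteq> arc_before W s"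
    using arc_before_after[OF assms(1), of s] by metis
  define t where "t = s - min e e' / 2"
  have "K t \<in> b"
    using e e'(1) by (force simp: t_def)
  moreover have "K t \<in> arc_before W s"
    using e(1) e'(1,3) by (force simp: t_def)
  moreover obtain b' where "b' \<in> components (range K - U)" "arc_before W s \<subseteq> b'"
    using component_refines[OF assms(2) e'(2)] by metis
  ultimately show ?thesis
    using that e'(2) assms(3) components_eq[of b _ b'] by blast
qed

end

section \<open>Arcs and crossings of a regular diagram\<close>

abbreviation incoming_at :: "diagram \<Rightarrow> position \<Rightarrow> arc"
  where "incoming_at D p \<equiv> closed_curve.arc_before (D ! fst p) (under_points D) (snd p)"

abbreviation outgoing_at :: "diagram \<Rightarrow> position \<Rightarrow> arc"
  where "outgoing_at D p \<equiv> closed_curve.arc_after (D ! fst p) (under_points D) (snd p)"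

locale diagram =
  fixes D :: diagram
  assumes regular: "regular_diagram D"
begin

lemma closed_curve: "i < length D \<Longrightarrow> closed_curve (D ! i)"
proof
  assume i: "i < length D"
  have C1: "C1_link D" using regular by (simp add: regular_diagram_def)
  then have "(D ! i) C1_differentiable_on UNIV"
    using i by (simp add: C1_link_def)
  then show "continuous_on UNIV (D ! i)"
    by (rule C1_differentiable_imp_continuous_on)
  show "(D ! i) (s + 1) = (D ! i) s" for s
    using i C1 by (simp add: C1_link_def embedded_curves_def)
  show "(D ! i) s = (D ! i) t \<Longrightarrow> s - t \<in> \<int>" for s t
    using i C1 by (simp add: C1_link_def embedded_curves_def)
qed

lemma component_of_point:
  assumes "(D ! i) s = (D ! j) t" "i < length D" "j < length D"
  shows "i = j"
  using regular assms by (auto simp: regular_diagram_def C1_link_def embedded_curves_def)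

lemma finite_under: "finite (under_points D)"
  using regular by (simp add: regular_diagram_def under_points_def)

lemma arcs_disjoint:
  assumes "a \<in> arcs_of_component D i" "b \<in> arcs_of_component D j" "i < length D" "j < length D"
    "x \<in> a" "x \<in> b"
  shows "i = j" "a = b"
proof -
  have "x \<in> range (D ! i)" "x \<in> range (D ! j)"
    using assms in_components_subset unfolding arcs_of_component_def by blast+
  then show ij: "i = j"
    using component_of_point assms(3,4) by blast
  show "a = b"
    using assms ij components_eq unfolding arcs_of_component_def by blast
qed

lemma arc_index_eq:
  assumes "a \<in> arcs_of_component D i" "i < length D"
  shows "arc_index D a = i"
  unfolding arc_index_def
proof (rule the_equality)
  have "a \<noteq> {}" using assms(1) in_components_nonempty unfolding arcs_of_component_def by blast
  then show "j = i" if "j < length D \<and> a \<in> arcs_of_component D j" for j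
    using arcs_disjoint(1) assms that by blast
qed (use assms in simp)

lemma arcs_iff: "a \<in> arcs D \<longleftrightarrow> arc_index D a < length D \<and> a \<in> arcs_of_component D (arc_index D a)"
  unfolding arcs_def using arc_index_eq by fastforce

lemma arcsI: "a \<in> arcs_of_component D i \<Longrightarrow> i < length D \<Longrightarrow> a \<in> arcs D"
  by (auto simp: arcs_def)

lemma crossing_positions:
  assumes "c \<in> crossings D"
  shows "fst (fst c) < length D" "fst (snd c) < length D"
  using assms by (auto simp: crossings_def positions_def)

lemma crossing_eqI:
  assumes "c \<in> crossings D" "c' \<in> crossings D"
    and "fst (point_at D (fst c)) = fst (point_at D (fst c'))"
  shows "c = c'"
proof -
  have "inj_on (\<lambda>(p, q). fst (point_at D p)) (crossings D)"
    using regular by (simp add: regular_diagram_def)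
  from inj_onD[OF this, of c c'] show ?thesis
    using assms by (simp add: case_prod_unfold)
qed

lemma crossing_point:
  assumes "c \<in> crossings D"
  shows "fst (point_at D (fst c)) = fst (point_at D (snd c))"
    "snd (point_at D (fst c)) > snd (point_at D (snd c))"
  using assms by (auto simp: crossings_def)

text \<open>
  If an overpassing point were also an underpassing point, two different crossings would lie over
  the same point of the plane, and there are no triple points.
\<close>

lemma over_point_not_under:
  assumes "c \<in> crossings D"
  shows "point_at D (fst c) \<notin> under_points D"
proof
  assume "point_at D (fst c) \<in> under_points D"
  then obtain c' where c': "c' \<in> crossings D" "point_at D (fst c) = point_at D (snd c')"
    by (auto simp: under_points_def)
  then have "c = c'"
    using crossing_point[OF c'(1)] assms by (intro crossing_eqI) auto
  then show False
    using c' crossing_point(2)[OF c'(1)] by simp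
qed

lemma incoming_at_component:
  "fst p < length D \<Longrightarrow> incoming_at D p \<in> arcs_of_component D (fst p)"
  using closed_curve.arc_before_after[OF closed_curve finite_under, of "fst p" "snd p"]
  unfolding arcs_of_component_def by metis

lemma outgoing_at_component:
  "fst p < length D \<Longrightarrow> outgoing_at D p \<in> arcs_of_component D (fst p)"
  using closed_curve.arc_before_after[OF closed_curve finite_under, of "fst p" "snd p"]
  unfolding arcs_of_component_def by metis

lemma over_arc_eq:
  assumes c: "c \<in> crossings D"
  shows "over_arc D c = incoming_at D (fst c)" "point_at D (fst c) \<in> incoming_at D (fst c)"
proof -
  note i = crossing_positions(1)[OF c]
  have "(D ! fst (fst c)) (snd (fst c)) \<notin> under_points D"
    using over_point_not_under[OF c] by (simp add: point_at_def)
  then show p: "point_at D (fst c) \<in> incoming_at D (fst c)"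
    using closed_curve.arc_through(4)[OF closed_curve[OF i] finite_under] by (simp add: point_at_def)
  show "over_arc D c = incoming_at D (fst c)"
    unfolding over_arc_def
  proof (rule the_equality)
    show "incoming_at D (fst c) \<in> arcs D \<and> point_at D (fst c) \<in> incoming_at D (fst c)"
      using p incoming_at_component[OF i] arcsI[OF _ i] by blast
  next
    fix a assume "a \<in> arcs D \<and> point_at D (fst c) \<in> a"
    then show "a = incoming_at D (fst c)"
      using arcs_iff[of a] arcs_disjoint(2)[OF _ incoming_at_component[OF i] _ i _ p] by blast
  qed
qed

lemma incoming_arc_eq:
  assumes c: "c \<in> crossings D"
  shows "incoming_arc D c = incoming_at D (snd c)"
  unfolding incoming_arc_def
proof (rule the_equality)
  let ?K = "D ! fst (snd c)" and ?t = "snd (snd c)"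
  note i = crossing_positions(2)[OF c]
  obtain e where e: "e > 0" "?K ` {?t - e<..<?t} \<subseteq> incoming_at D (snd c)"
    using closed_curve.arc_before_after[OF closed_curve[OF i] finite_under, of ?t] by metis
  show *: "incoming_at D (snd c) \<in> arcs D \<and>
    (\<forall>\<^sub>F s in at_left ?t. point_at D (fst (snd c), s) \<in> incoming_at D (snd c))"
  proof
    show "incoming_at D (snd c) \<in> arcs D"
      using incoming_at_component[OF i] arcsI[OF _ i] by blast
    have "point_at D (fst (snd c), s) \<in> incoming_at D (snd c)" if "s > ?t - e" "s < ?t" for s
    proof -
      have "s \<in> {?t - e<..<?t}" using that by simp
      then show ?thesis using e(2) unfolding point_at_def fst_conv snd_conv by blast
    qed
    then show "\<forall>\<^sub>F s in at_left ?t. point_at D (fst (snd c), s) \<in> incoming_at D (snd c)"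
      using e(1) unfolding eventually_at_left_field by (intro exI[of _ "?t - e"]) auto
  qed
  fix a assume a: "a \<in> arcs D \<and> (\<forall>\<^sub>F s in at_left ?t. point_at D (fst (snd c), s) \<in> a)"
  then have "\<forall>\<^sub>F s in at_left ?t. point_at D (fst (snd c), s) \<in> a \<and> point_at D (fst (snd c), s) \<in> incoming_at D (snd c)"
    using * eventually_conj by blast
  then obtain s where "point_at D (fst (snd c), s) \<in> a" "point_at D (fst (snd c), s) \<in> incoming_at D (snd c)"
    using eventually_happens' trivial_limit_at_left_real by blast
  then show "a = incoming_at D (snd c)"
    using a arcs_iff[of a] arcs_disjoint(2)[OF _ incoming_at_component[OF i] _ i] by blast
qed

lemma outgoing_arc_eq:
  assumes c: "c \<in> crossings D"
  shows "outgoing_arc D c = outgoing_at D (snd c)"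
  unfolding outgoing_arc_def
proof (rule the_equality)
  let ?K = "D ! fst (snd c)" and ?t = "snd (snd c)"
  note i = crossing_positions(2)[OF c]
  obtain e where e: "e > 0" "?K ` {?t<..<?t + e} \<subseteq> outgoing_at D (snd c)"
    using closed_curve.arc_before_after[OF closed_curve[OF i] finite_under, of ?t] by metis
  show *: "outgoing_at D (snd c) \<in> arcs D \<and>
    (\<forall>\<^sub>F s in at_right ?t. point_at D (fst (snd c), s) \<in> outgoing_at D (snd c))"
  proof
    show "outgoing_at D (snd c) \<in> arcs D"
      using outgoing_at_component[OF i] arcsI[OF _ i] by blast
    have "point_at D (fst (snd c), s) \<in> outgoing_at D (snd c)" if "s > ?t" "s < ?t + e" for s
    proof -
      have "s \<in> {?t<..<?t + e}" using that by simp
      then show ?thesis using e(2) unfolding point_at_def fst_conv snd_conv by blast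
    qed
    then show "\<forall>\<^sub>F s in at_right ?t. point_at D (fst (snd c), s) \<in> outgoing_at D (snd c)"
      using e(1) unfolding eventually_at_right_field by (intro exI[of _ "?t + e"]) auto
  qed
  fix a assume a: "a \<in> arcs D \<and> (\<forall>\<^sub>F s in at_right ?t. point_at D (fst (snd c), s) \<in> a)"
  then have "\<forall>\<^sub>F s in at_right ?t. point_at D (fst (snd c), s) \<in> a \<and> point_at D (fst (snd c), s) \<in> outgoing_at D (snd c)"
    using * eventually_conj by blast
  then obtain s where "point_at D (fst (snd c), s) \<in> a" "point_at D (fst (snd c), s) \<in> outgoing_at D (snd c)"
    using eventually_happens' trivial_limit_at_right_real by blast
  then show "a = outgoing_at D (snd c)"
    using a arcs_iff[of a] arcs_disjoint(2)[OF _ outgoing_at_component[OF i] _ i] by blast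
qed

lemma crossing_arcs:
  assumes c: "c \<in> crossings D"
  shows "over_arc D c \<in> arcs_of_component D (fst (fst c))"
    "left_arc D c \<in> arcs_of_component D (fst (snd c))"
    "right_arc D c \<in> arcs_of_component D (fst (snd c))"
    "arc_index D (over_arc D c) = fst (fst c)"
    "arc_index D (left_arc D c) = fst (snd c)"
    "arc_index D (right_arc D c) = fst (snd c)"
    "over_arc D c \<in> arcs D" "left_arc D c \<in> arcs D" "right_arc D c \<in> arcs D"
proof -
  note i = crossing_positions[OF c]
  show *: "over_arc D c \<in> arcs_of_component D (fst (fst c))"
    "left_arc D c \<in> arcs_of_component D (fst (snd c))"
    "right_arc D c \<in> arcs_of_component D (fst (snd c))"
    using incoming_at_component[OF i(1)] incoming_at_component[OF i(2)] outgoing_at_component[OF i(2)]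
    by (simp_all add: over_arc_eq[OF c] left_arc_def right_arc_def incoming_arc_eq[OF c] outgoing_arc_eq[OF c])
  show "arc_index D (over_arc D c) = fst (fst c)"
    "arc_index D (left_arc D c) = fst (snd c)"
    "arc_index D (right_arc D c) = fst (snd c)"
    "over_arc D c \<in> arcs D" "left_arc D c \<in> arcs D" "right_arc D c \<in> arcs D"
    using * i arc_index_eq arcsI by blast+
qed

text \<open>
  Specialization of \<open>gluing\<close> to diagrams. It does not matter which of the two arcs at an underpassing point is
  the left one, as only their equality under \<open>h\<close> is asked for.
\<close>

lemma arcs_glued:
  assumes i: "i < length D" and U: "U \<subseteq> under_points D"
    and b: "b \<in> components (range (D ! i) - U)"
    and a: "a \<in> arcs_of_component D i" "a \<subseteq> b"
    and a': "a' \<in> arcs_of_component D i" "a' \<subseteq> b"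
    and glue: "\<And>c. c \<in> crossings D \<Longrightarrow> fst (snd c) = i \<Longrightarrow> point_at D (snd c) \<notin> U \<Longrightarrow>
      h (left_arc D c) = h (right_arc D c)"
  shows "h a = h a'"
proof (rule closed_curve.gluing[OF closed_curve[OF i] finite_under U _ b])
  show "a \<in> components (range (D ! i) - under_points D)" "a' \<in> components (range (D ! i) - under_points D)"
    using a a' by (simp_all add: arcs_of_component_def)
  fix s assume s: "(D ! i) s \<in> under_points D - U"
  then obtain c where c: "c \<in> crossings D" "(D ! i) s = point_at D (snd c)"
    by (auto simp: under_points_def)
  have j: "fst (snd c) = i"
    using component_of_point[of i s "fst (snd c)" "snd (snd c)"] c i crossing_positions(2)[OF c(1)]
    by (simp add: point_at_def)
  have eq: "(D ! i) s = (D ! i) (snd (snd c))"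
    using c(2) j by (simp add: point_at_def)
  have "h (incoming_arc D c) = h (outgoing_arc D c)"
    using glue[OF c(1) j] s c(2) by (auto simp: left_arc_def right_arc_def split: if_splits)
  then show "h (closed_curve.arc_before (D ! i) (under_points D) s) = h (closed_curve.arc_after (D ! i) (under_points D) s)"
    using closed_curve.arc_before_shift[OF closed_curve[OF i] finite_under eq]
      closed_curve.arc_after_shift[OF closed_curve[OF i] finite_under eq]
    by (simp add: incoming_arc_eq[OF c(1)] outgoing_arc_eq[OF c(1)] j)
qed (use a a' in simp_all)

lemma whole_curve_component:
  "i < length D \<Longrightarrow> components (range (D ! i) - {}) = {range (D ! i)}"
  using closed_curve.continuous[OF closed_curve] connected_continuous_image[of UNIV "D ! i"]
  by (simp add: components_eq_sing_iff)

lemma component_arcs_glued: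
  assumes i: "i < length D" and a: "a \<in> arcs_of_component D i" "a' \<in> arcs_of_component D i"
    and glue: "\<And>c. c \<in> crossings D \<Longrightarrow> fst (snd c) = i \<Longrightarrow> h (left_arc D c) = h (right_arc D c)"
  shows "h a = h a'"
proof (rule arcs_glued[OF i, of "{}" "range (D ! i)"])
  show "range (D ! i) \<in> components (range (D ! i) - {})"
    using whole_curve_component[OF i] by simp
  show "a \<subseteq> range (D ! i)" "a' \<subseteq> range (D ! i)"
    using a in_components_subset unfolding arcs_of_component_def by blast+
qed (use a glue in auto)

lemma component_has_arc:
  assumes "i < length D"
  obtains a where "a \<in> arcs_of_component D i"
proof -
  have "range (D ! i) \<in> components (range (D ! i) - {})"
    using whole_curve_component[OF assms] by simp
  then show ?thesis
    using closed_curve.component_contains[OF closed_curve[OF assms] finite_under empty_subsetI] that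
    unfolding arcs_of_component_def by metis
qed

section \<open>The quandle of a diagram\<close>

text \<open>
  Both underpassing arcs of a crossing have the same index \<open>l\<close>. With \<open>o\<close> the index of the over arc the
  relation is sent to \<open>(1 - t\<^sub>l) (t\<^sub>o - 1) + t\<^sub>o (t\<^sub>l - 1) - (t\<^sub>l - 1) = 0\<close>.
\<close>

lemma phi_relations:
  assumes "v \<in> relations D" shows "phi D v = 0"
proof -
  obtain w where w: "w \<in> carrier (free_module (length D) (crossings D))" "v = rho D w"
    using assms unfolding relations_def by blast
  have "phi D (scale r (crossing_relation D c)) = 0" if "c \<in> Poly_Mapping.keys w" for r c
  proof -
    have c: "c \<in> crossings D" using w(1) that by (auto simp: free_module_carrier)
    show ?thesis
      by (simp add: phi_scale crossing_relation_def phi_add phi_diff phi_single crossing_arcs[OF c] algebra_simps)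
  qed
  then show ?thesis
    unfolding w(2) rho_def additive.sum[OF additive_phi] by (intro sum.neutral) blast
qed

lemma crowell_gamma: "crowell D (gamma D v) = phi D v"
proof -
  have "phi D w = phi D v" if "w \<in> gamma D v" for w
    using that phi_relations by (auto simp: gamma_eq phi_add)
  moreover have "v \<in> gamma D v"
    using relations_zero[of D] by (auto simp: gamma_eq)
  ultimately have "phi D ` gamma D v = {phi D v}"
    by blast
  moreover have "crowell D (gamma D v) = the_elem (phi D ` gamma D v)"
    by (simp add: crowell_def phi_def extend_def)
  ultimately show ?thesis by simp
qed

text \<open>
  The orbit of a component, described by the Crowell map. That these sets are the quandle orbits is
  \<open>quandle_orbits_eq\<close>, and that they carry the right labels is \<open>component_orbit_eq\<close>.
\<close>

definition orbit :: "nat \<Rightarrow> alexander_element set"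
  where "orbit i = {x \<in> alexander_set D. crowell D x = laurent_var i - 1}"

definition represents :: "(arc \<Rightarrow>\<^sub>0 laurent) \<Rightarrow> nat \<Rightarrow> bool"
  where "represents v i \<longleftrightarrow> i < length D \<and> v \<in> carrier (arc_module D) \<and> phi D v = laurent_var i - 1"

text \<open>
  On elements with known indices the quandle operations are linear in the representatives.
  This is the reason why quandle maps that respect indices come from linear maps.
\<close>

lemma op_gamma:
  assumes "represents v i" "represents w j"
  shows "alexander_op D (gamma D v) (gamma D w) = gamma D (scale (laurent_var j) v - scale (laurent_var i - 1) w)"
    "represents (scale (laurent_var j) v - scale (laurent_var i - 1) w) i"
proof -
  have v: "v \<in> carrier (arc_module D)" "phi D v = laurent_var i - 1" "i < length D"
    and w: "w \<in> carrier (arc_module D)" "phi D w = laurent_var j - 1" "j < length D"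
    using assms by (simp_all add: represents_def)
  have sw: "scale (laurent_var i - 1) w \<in> carrier (arc_module D)"
    using v w by (intro free_module_scale) simp_all
  show "alexander_op D (gamma D v) (gamma D w) = gamma D (scale (laurent_var j) v - scale (laurent_var i - 1) w)"
    using v(3) w(3) by (simp add: alexander_op_def crowell_gamma v(2) w(2) gamma_scale gamma_diff[OF sw])
  have "phi D (scale (laurent_var j) v - scale (laurent_var i - 1) w) = laurent_var i - 1"
    unfolding phi_diff phi_scale v(2) w(2) by (simp add: algebra_simps)
  then show "represents (scale (laurent_var j) v - scale (laurent_var i - 1) w) i"
    using v w sw by (simp add: represents_def free_module_scale free_module_diff)
qed

lemma op_inv_gamma:
  assumes "represents v i" "represents w j"
  shows "alexander_op_inv D (gamma D v) (gamma D w)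
      = gamma D (scale (laurent_var_inv j) (v + scale (laurent_var i - 1) w))"
    "represents (scale (laurent_var_inv j) (v + scale (laurent_var i - 1) w)) i"
proof -
  have v: "v \<in> carrier (arc_module D)" "phi D v = laurent_var i - 1" "i < length D"
    and w: "w \<in> carrier (arc_module D)" "phi D w = laurent_var j - 1" "j < length D"
    using assms by (simp_all add: represents_def)
  show "alexander_op_inv D (gamma D v) (gamma D w)
      = gamma D (scale (laurent_var_inv j) (v + scale (laurent_var i - 1) w))"
    using v(3) w(3)
    by (simp add: alexander_op_inv_def crowell_gamma v(2) w(2) gamma_scale gamma_add inv_laurent_var)
  have "phi D (scale (laurent_var_inv j) (v + scale (laurent_var i - 1) w))
      = laurent_var_inv j * (laurent_var i - 1 + (laurent_var i - 1) * (laurent_var j - 1))"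
    unfolding phi_add phi_scale v(2) w(2) ..
  also have "\<dots> = (laurent_var_inv j * laurent_var j) * (laurent_var i - 1)"
    by (simp only: algebra_simps) simp
  finally show "represents (scale (laurent_var_inv j) (v + scale (laurent_var i - 1) w)) i"
    using v w by (simp add: represents_def free_module_scale free_module_add)
qed

lemma represents_arc:
  assumes "a \<in> arcs_of_component D i" "i < length D"
  shows "represents (Poly_Mapping.single a 1) i"
  using assms(2) free_module_single[OF arcsI[OF assms] laurent_one]
  by (simp add: represents_def phi_single arc_index_eq[OF assms])

lemma element_represented:
  assumes "x \<in> alexander_set D"
  obtains v i where "x = gamma D v" "represents v i"
proof -
  from assms have "\<exists>v i. x = gamma D v \<and> represents v i"
  proof induction
    case (generator a)
    then show ?case
      using represents_arc arcs_iff[of a] unfolding arc_class_def by blast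
  next
    case (op x y)
    then show ?case using op_gamma by blast
  next
    case (op_inv x y)
    then show ?case using op_inv_gamma by blast
  qed
  then show ?thesis using that by blast
qed

lemma orbit_iff: "x \<in> orbit i \<longleftrightarrow> x \<in> alexander_set D \<and> (\<exists>v. x = gamma D v \<and> represents v i)"
proof
  assume x: "x \<in> orbit i"
  then obtain v j where v: "x = gamma D v" "represents v j"
    using element_represented unfolding orbit_def by blast
  then have "i = j"
    using x by (simp add: orbit_def crowell_gamma represents_def)
  then show "x \<in> alexander_set D \<and> (\<exists>v. x = gamma D v \<and> represents v i)"
    using x v unfolding orbit_def by blast
next
  assume "x \<in> alexander_set D \<and> (\<exists>v. x = gamma D v \<and> represents v i)"
  then obtain v where "x \<in> alexander_set D" "x = gamma D v" "phi D v = laurent_var i - 1"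
    unfolding represents_def by blast
  then show "x \<in> orbit i"
    using crowell_gamma[of v] by (simp add: orbit_def)
qed

lemma orbitE:
  assumes "x \<in> orbit i" obtains v where "x = gamma D v" "represents v i"
  using assms that unfolding orbit_iff by blast

lemma orbit_subset: "x \<in> orbit i \<Longrightarrow> x \<in> alexander_set D"
  by (simp add: orbit_def)

lemma orbit_index: "x \<in> orbit i \<Longrightarrow> i < length D"
  by (elim orbitE) (simp add: represents_def)

lemma orbit_unique: "x \<in> orbit i \<Longrightarrow> x \<in> orbit j \<Longrightarrow> i = j"
  by (simp add: orbit_def)

lemma in_some_orbit:
  assumes "x \<in> alexander_set D" obtains i where "i < length D" "x \<in> orbit i"
proof -
  obtain v i where "x = gamma D v" "represents v i"
    using element_represented[OF assms] .
  then have "x \<in> orbit i" using assms unfolding orbit_iff by blast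
  then show ?thesis using that orbit_index by blast
qed

lemma arc_in_orbit: 
  assumes "a \<in> arcs_of_component D i" "i < length D"
  shows "arc_class D a \<in> orbit i"
  unfolding orbit_iff
  using represents_arc[OF assms] alexander_set.generator[OF arcsI[OF assms]] arc_class_def by blast

lemma op_in_orbit:
  assumes "x \<in> orbit i" "y \<in> orbit j" shows "alexander_op D x y \<in> orbit i"
proof -
  obtain v w where *: "x = gamma D v" "represents v i" "y = gamma D w" "represents w j"
    using assms by (elim orbitE) blast
  have "alexander_op D x y \<in> alexander_set D"
    using assms alexander_set.op orbit_subset by blast
  then show ?thesis
    using op_gamma[OF *(2,4)] unfolding orbit_iff *(1,3) by blast
qed

lemma op_inv_in_orbit:
  assumes "x \<in> orbit i" "y \<in> orbit j" shows "alexander_op_inv D x y \<in> orbit i"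
proof -
  have "crowell D y = laurent_var j - 1" using assms(2) by (simp add: orbit_def)
  then have "crowell D y + 1 \<in> Units (laurent_ring (length D))"
    using orbit_index[OF assms(2)] laurent_var_Units by simp
  then have "alexander_op_inv D x y \<in> alexander_set D"
    using assms alexander_set.op_inv orbit_subset by blast
  moreover obtain v w where *: "x = gamma D v" "represents v i" "y = gamma D w" "represents w j"
    using assms by (elim orbitE) blast
  ultimately show ?thesis
    using op_inv_gamma[OF *(2,4)] unfolding orbit_iff *(1,3) by blast
qed

lemma orbit_induct [consumes 1, case_names arc op op_inv]:
  assumes "x \<in> orbit i"
    and "\<And>a i. i < length D \<Longrightarrow> a \<in> arcs_of_component D i \<Longrightarrow> P i (arc_class D a)"
    and "\<And>x y i j. x \<in> orbit i \<Longrightarrow> y \<in> orbit j \<Longrightarrow> P i x \<Longrightarrow> P j y \<Longrightarrow> P i (alexander_op D x y)"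
    and "\<And>x y i j. x \<in> orbit i \<Longrightarrow> y \<in> orbit j \<Longrightarrow> P i x \<Longrightarrow> P j y \<Longrightarrow> P i (alexander_op_inv D x y)"
  shows "P i x"
proof -
  have "x \<in> alexander_set D" using assms(1) orbit_subset by blast
  then have "\<forall>i. x \<in> orbit i \<longrightarrow> P i x"
  proof induction
    case (generator a)
    then show ?case
      using arcs_iff[of a] arc_in_orbit assms(2) orbit_unique by blast
  next
    case (op x y)
    then obtain i j where "x \<in> orbit i" "y \<in> orbit j" using in_some_orbit by metis
    then show ?case
      using op assms(3) op_in_orbit orbit_unique by blast
  next
    case (op_inv x y)
    then obtain i j where "x \<in> orbit i" "y \<in> orbit j" using in_some_orbit by metis
    then show ?case
      using op_inv assms(4) op_inv_in_orbit orbit_unique by blast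
  qed
  then show ?thesis using assms(1) by blast
qed

lemma op_inv_op:
  assumes "x \<in> orbit i" "y \<in> orbit j"
  shows "alexander_op_inv D (alexander_op D x y) y = x"
proof -
  obtain v w where *: "x = gamma D v" "represents v i" "y = gamma D w" "represents w j"
    using assms by (elim orbitE) blast
  show ?thesis
    unfolding * op_gamma(1)[OF *(2,4)] op_inv_gamma(1)[OF op_gamma(2)[OF *(2,4)] *(4)] by simp
qed

lemma op_op_inv:
  assumes "x \<in> orbit i" "y \<in> orbit j"
  shows "alexander_op D (alexander_op_inv D x y) y = x"
proof -
  obtain v w where *: "x = gamma D v" "represents v i" "y = gamma D w" "represents w j"
    using assms by (elim orbitE) blast
  show ?thesis
    unfolding * op_inv_gamma(1)[OF *(2,4)] op_gamma(1)[OF op_inv_gamma(2)[OF *(2,4)] *(4)] by simp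
qed

text \<open>
  The crossing relation, read in the quandle. Every step from quandle maps to linear maps and back
  goes through this equation.
\<close>

lemma crossing_op:
  assumes c: "c \<in> crossings D"
  shows "arc_class D (left_arc D c) = alexander_op D (arc_class D (right_arc D c)) (arc_class D (over_arc D c))"
proof -
  note i = crossing_positions[OF c]
  have r: "represents (Poly_Mapping.single (right_arc D c) 1) (fst (snd c))"
    "represents (Poly_Mapping.single (over_arc D c) 1) (fst (fst c))"
    using represents_arc crossing_arcs[OF c] i by blast+
  have "scale (laurent_var (fst (fst c))) (Poly_Mapping.single (right_arc D c) 1)
      - scale (laurent_var (fst (snd c)) - 1) (Poly_Mapping.single (over_arc D c) 1)
      - Poly_Mapping.single (left_arc D c) 1 = crossing_relation D c"
    by (simp add: crossing_relation_def crossing_arcs[OF c] scale_single single_diff)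
  then show ?thesis
    unfolding arc_class_def op_gamma(1)[OF r]
    using crossing_relation_in_relations[OF c] by (metis gamma_eq_iff)
qed

lemma stable_op_iff:
  assumes X: "stable_subset (alexander_quandle D) X" and "x \<in> orbit i" "y \<in> orbit j"
  shows "alexander_op D x y \<in> X \<longleftrightarrow> x \<in> X" "alexander_op_inv D x y \<in> X \<longleftrightarrow> x \<in> X"
proof -
  have st: "alexander_op D z y \<in> X" "alexander_op_inv D z y \<in> X" if "z \<in> X" for z
    using X that assms(3) orbit_subset by (auto simp: stable_subset_def alexander_quandle_def)
  show "alexander_op D x y \<in> X \<longleftrightarrow> x \<in> X" "alexander_op_inv D x y \<in> X \<longleftrightarrow> x \<in> X"
    using st op_inv_op[OF assms(2,3)] op_op_inv[OF assms(2,3)] by metis+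
qed

text \<open>
  Acting on an element does not change whether it belongs to the stable set \<open>X\<close>. So for arcs
  membership agrees on the two sides of each crossing, hence along the whole component, and for
  other elements it is decided by the arc from which they are generated.
\<close>

lemma stable_contains_orbit:
  assumes X: "stable_subset (alexander_quandle D) X" and x: "x \<in> X" "x \<in> orbit i"
  shows "orbit i \<subseteq> X"
proof -
  have glue: "arc_class D a \<in> X \<longleftrightarrow> arc_class D a' \<in> X"
    if "i < length D" "a \<in> arcs_of_component D i" "a' \<in> arcs_of_component D i" for i a a'
  proof (rule component_arcs_glued[OF that])
    fix c assume c: "c \<in> crossings D"
    note i = crossing_positions[OF c]
    have "arc_class D (right_arc D c) \<in> orbit (fst (snd c))" "arc_class D (over_arc D c) \<in> orbit (fst (fst c))"
      using arc_in_orbit crossing_arcs[OF c] i by blast+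
    from stable_op_iff(1)[OF X this]
    show "(arc_class D (left_arc D c) \<in> X) = (arc_class D (right_arc D c) \<in> X)"
      by (simp add: crossing_op[OF c])
  qed
  have to_arcs: "y \<in> X \<longleftrightarrow> (\<forall>a\<in>arcs_of_component D i. arc_class D a \<in> X)" if "y \<in> orbit i" for y i
    using that
  proof (induction rule: orbit_induct)
    case (arc a i)
    then show ?case using glue by blast
  next
    case (op x y i j)
    then show ?case using stable_op_iff(1)[OF X] by blast
  next
    case (op_inv x y i j)
    then show ?case using stable_op_iff(2)[OF X] by blast
  qed
  show ?thesis using x to_arcs by blast
qed

lemma stable_orbit:
  assumes "i < length D" shows "stable_subset (alexander_quandle D) (orbit i)"
proof -
  obtain a where "a \<in> arcs_of_component D i" using component_has_arc[OF assms] .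
  then have "orbit i \<noteq> {}" using arc_in_orbit assms by blast
  moreover have "alexander_op D x y \<in> orbit i" "alexander_op_inv D x y \<in> orbit i"
    if "x \<in> orbit i" "y \<in> alexander_set D" for x y
    using that op_in_orbit op_inv_in_orbit in_some_orbit by metis+
  ultimately show ?thesis
    by (auto simp: stable_subset_def alexander_quandle_def orbit_subset)
qed

lemma quandle_orbits_eq: "quandle_orbits (alexander_quandle D) = orbit ` {..<length D}"
proof (intro equalityI subsetI)
  fix X assume "X \<in> quandle_orbits (alexander_quandle D)"
  then have X: "stable_subset (alexander_quandle D) X"
    "\<And>Y. stable_subset (alexander_quandle D) Y \<Longrightarrow> Y \<subseteq> X \<Longrightarrow> Y = X"
    by (auto simp: quandle_orbits_def)
  then obtain x where x: "x \<in> X" "x \<in> alexander_set D"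
    by (auto simp: stable_subset_def alexander_quandle_def)
  then obtain i where i: "i < length D" "x \<in> orbit i" using in_some_orbit by metis
  then have "orbit i = X"
    using X stable_contains_orbit stable_orbit x by blast
  then show "X \<in> orbit ` {..<length D}" using i by blast
next
  fix X assume "X \<in> orbit ` {..<length D}"
  then obtain i where i: "i < length D" "X = orbit i" by blast
  have "Y = orbit i" if Y: "stable_subset (alexander_quandle D) Y" "Y \<subseteq> orbit i" for Y
  proof -
    obtain y where "y \<in> Y" using Y(1) by (auto simp: stable_subset_def)
    then show ?thesis using stable_contains_orbit[OF Y(1)] Y(2) by blast
  qed
  then show "X \<in> quandle_orbits (alexander_quandle D)"
    using stable_orbit i by (auto simp: quandle_orbits_def)
qed

lemma component_orbit_eq:
  assumes i: "i < length D" shows "component_orbit D i = orbit i"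
  unfolding component_orbit_def
proof (rule the_equality)
  show "orbit i \<in> quandle_orbits (alexander_quandle D) \<and> (\<forall>a\<in>arcs D. arc_index D a = i \<longrightarrow> arc_class D a \<in> orbit i)"
    using i quandle_orbits_eq arc_in_orbit arcs_iff by blast
next
  fix X assume X: "X \<in> quandle_orbits (alexander_quandle D) \<and> (\<forall>a\<in>arcs D. arc_index D a = i \<longrightarrow> arc_class D a \<in> X)"
  obtain a where a: "a \<in> arcs_of_component D i" using component_has_arc[OF i] .
  then have "arc_class D a \<in> X" "arc_class D a \<in> orbit i"
    using X i arc_index_eq arcsI arc_in_orbit by blast+
  then show "X = orbit i"
    using X orbit_unique unfolding quandle_orbits_eq by blast
qed

lemma inj_orbit: "inj_on orbit {..<length D}"
proof (rule inj_onI)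
  fix i j assume i: "i \<in> {..<length D}" and eq: "orbit i = orbit j"
  then obtain a where "a \<in> arcs_of_component D i" using component_has_arc by blast
  then show "i = j" using i eq arc_in_orbit orbit_unique by blast
qed

end

section \<open>Deleting components\<close>

text \<open>
  The components to be kept are given by a list of their indices in \<open>D\<close>. The order of the list
  numbers the components of the subdiagram \<open>E\<close>, which covers re-indexing as well as deletion.
\<close>

locale subdiagram = diagram +
  fixes "is" :: "nat list"
  assumes distinct: "distinct is" and indices: "set is \<subseteq> {..<length D}"
begin

abbreviation E :: diagram
  where "E \<equiv> map ((!) D) is"

abbreviation lift_position :: "position \<Rightarrow> position"
  where "lift_position p \<equiv> (is ! fst p, snd p)"

definition lift_crossing :: "crossing \<Rightarrow> crossing"
  where "lift_crossing c = (lift_position (fst c), lift_position (snd c))"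

lemma index_less: "j < length is \<Longrightarrow> is ! j < length D"
  using indices nth_mem by blast

lemma index_eq_iff: "j < length is \<Longrightarrow> k < length is \<Longrightarrow> is ! j = is ! k \<longleftrightarrow> j = k"
  using distinct nth_eq_iff_index_eq by blast

lemma point_at_lift: "fst p < length is \<Longrightarrow> point_at D (lift_position p) = point_at E p"
  by (simp add: point_at_def)

lemma direction_at_lift: "fst p < length is \<Longrightarrow> direction_at D (lift_position p) = direction_at E p"
  by (simp add: direction_at_def)

lemma crossings_sub_iff:
  "c \<in> crossings E \<longleftrightarrow> fst (fst c) < length is \<and> fst (snd c) < length is \<and> lift_crossing c \<in> crossings D"
proof (cases "fst (fst c) < length is \<and> fst (snd c) < length is")
  case True
  have "point_at D (lift_position (fst c)) = point_at E (fst c)"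
    "point_at D (lift_position (snd c)) = point_at E (snd c)"
    using True point_at_lift by blast+
  then show ?thesis
    using True index_less by (auto simp: crossings_def positions_def lift_crossing_def mem_Times_iff case_prod_beta)
next
  case False
  then show ?thesis by (auto simp: crossings_def positions_def)
qed

lemma inj_lift_crossing: "inj_on lift_crossing (crossings E)"
proof (rule inj_onI)
  fix c c' assume "c \<in> crossings E" "c' \<in> crossings E" "lift_crossing c = lift_crossing c'"
  then show "c = c'"
    unfolding crossings_sub_iff lift_crossing_def
    by (auto simp: index_eq_iff prod_eq_iff)
qed

lemma regular_sub: "regular_diagram E"
proof -
  have C1: "C1_link D" and dir: "\<And>p. fst p < length D \<Longrightarrow> direction_at D p \<noteq> 0"
    and fin: "finite (crossings D)"
    and cross: "\<And>c. c \<in> crossings D \<Longrightarrow> cross2 (direction_at D (fst c)) (direction_at D (snd c)) \<noteq> 0"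
    using regular by (auto simp: regular_diagram_def)
  have "embedded_curves E"
    unfolding embedded_curves_def
  proof (intro conjI allI impI ballI)
    fix K s assume "K \<in> set E"
    then have "K \<in> set D" using indices by auto
    then show "K (s + 1) = K s" using C1 by (simp add: C1_link_def embedded_curves_def)
  next
    fix i j s t assume ij: "i < length E" "j < length E" and "(E ! i) s = (E ! j) t"
    then have eq: "(D ! (is ! i)) s = (D ! (is ! j)) t" by simp
    have *: "\<And>i j s t. i < length D \<Longrightarrow> j < length D \<Longrightarrow> (D ! i) s = (D ! j) t \<Longrightarrow> i = j \<and> s - t \<in> \<int>"
      using C1 by (simp add: C1_link_def embedded_curves_def)
    show "i = j" "s - t \<in> \<int>"
      using *[OF _ _ eq] ij index_less index_eq_iff by auto
  qed
  moreover have "K \<in> set D" if "K \<in> set E" for K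
    using that indices by auto
  ultimately have "C1_link E"
    using C1 by (simp add: C1_link_def)
  moreover have "direction_at E p \<noteq> 0" if "fst p < length E" for p
    using that dir[of "lift_position p"] direction_at_lift[of p] index_less by simp
  moreover have "finite (crossings E)"
  proof (rule finite_imageD[OF _ inj_lift_crossing])
    have "lift_crossing ` crossings E \<subseteq> crossings D" using crossings_sub_iff by blast
    then show "finite (lift_crossing ` crossings E)" using fin finite_subset by blast
  qed
  moreover have "cross2 (direction_at E (fst c)) (direction_at E (snd c)) \<noteq> 0" if "c \<in> crossings E" for c
    using that cross[of "lift_crossing c"] direction_at_lift[of "fst c"] direction_at_lift[of "snd c"]
    unfolding crossings_sub_iff by (simp add: lift_crossing_def)
  moreover have "inj_on (\<lambda>c. fst (point_at E (fst c))) (crossings E)"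
  proof (rule inj_onI)
    fix c c' assume c: "c \<in> crossings E" "c' \<in> crossings E"
      "fst (point_at E (fst c)) = fst (point_at E (fst c'))"
    then have "fst (point_at D (fst (lift_crossing c))) = fst (point_at D (fst (lift_crossing c')))"
      using point_at_lift[of "fst c"] point_at_lift[of "fst c'"] unfolding crossings_sub_iff
      by (simp add: lift_crossing_def)
    then have "lift_crossing c = lift_crossing c'"
      using c crossing_eqI unfolding crossings_sub_iff by blast
    then show "c = c'" using c inj_onD[OF inj_lift_crossing] by blast
  qed
  ultimately show ?thesis
    by (simp add: regular_diagram_def case_prod_unfold)
qed

sublocale sub: diagram E
  using regular_sub by unfold_locales

lemma under_points_sub: "under_points E \<subseteq> under_points D"
proof
  fix x assume "x \<in> under_points E"
  then obtain c where c: "c \<in> crossings E" "x = point_at E (snd c)"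
    by (auto simp: under_points_def)
  then have "lift_crossing c \<in> crossings D" "x = point_at D (snd (lift_crossing c))"
    using point_at_lift[of "snd c"] unfolding crossings_sub_iff by (simp_all add: lift_crossing_def)
  then show "x \<in> under_points D"
    by (auto simp: under_points_def)
qed

text \<open>
  Deleting components removes underpassing points, so each arc of \<open>D\<close> on a kept component lies in
  exactly one arc of \<open>E\<close>.
\<close>

definition merge :: "arc \<Rightarrow> arc"
  where "merge a = (THE b. b \<in> arcs E \<and> a \<subseteq> b)"

lemma merge_eqI:
  assumes "a \<noteq> {}" "b \<in> arcs_of_component E j" "j < length is" "a \<subseteq> b"
  shows "merge a = b"
  unfolding merge_def
proof (rule the_equality)
  show "b \<in> arcs E \<and> a \<subseteq> b" using assms sub.arcsI by simp
  fix b' assume b': "b' \<in> arcs E \<and> a \<subseteq> b'"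
  obtain x where "x \<in> a" using assms(1) by blast
  then show "b' = b"
    using b' assms sub.arcs_iff[of b'] sub.arcs_disjoint(2)[of b' _ b j x] by auto
qed

lemma arc_nonempty: "a \<in> arcs_of_component D i \<Longrightarrow> a \<noteq> {}"
  unfolding arcs_of_component_def using in_components_nonempty by blast

lemma merge_arc:
  assumes "j < length is" "a \<in> arcs_of_component D (is ! j)"
  shows "merge a \<in> arcs_of_component E j" "a \<subseteq> merge a"
proof -
  have "a \<in> components (range (D ! (is ! j)) - under_points D)"
    using assms(2) by (simp add: arcs_of_component_def)
  then obtain b where b: "b \<in> components (range (D ! (is ! j)) - under_points E)" "a \<subseteq> b"
    using closed_curve.component_refines[OF closed_curve[OF index_less[OF assms(1)]] under_points_sub] by blast
  then have bE: "b \<in> arcs_of_component E j"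
    using assms(1) by (simp add: arcs_of_component_def)
  have "merge a = b"
    using merge_eqI[OF arc_nonempty[OF assms(2)] bE assms(1) b(2)] .
  with b bE show "merge a \<in> arcs_of_component E j" "a \<subseteq> merge a" by simp_all
qed

lemma merge_surj:
  assumes "j < length is" "b \<in> arcs_of_component E j"
  obtains a where "a \<in> arcs_of_component D (is ! j)" "merge a = b"
proof -
  have "b \<in> components (range (D ! (is ! j)) - under_points E)"
    using assms by (simp add: arcs_of_component_def)
  then obtain a where a: "a \<in> components (range (D ! (is ! j)) - under_points D)" "a \<subseteq> b"
    using closed_curve.component_contains[OF closed_curve[OF index_less[OF assms(1)]] finite_under under_points_sub] by blast
  then have "a \<in> arcs_of_component D (is ! j)" by (simp add: arcs_of_component_def)
  then show ?thesis
    using that merge_eqI[OF arc_nonempty assms(2,1) a(2)] by blast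
qed

lemma merge_incoming:
  assumes "j < length is" shows "merge (incoming_at D (is ! j, s)) = incoming_at E (j, s)"
proof (rule merge_eqI[OF arc_nonempty _ assms])
  show "incoming_at D (is ! j, s) \<in> arcs_of_component D (is ! j)"
    using incoming_at_component[of "(is ! j, s)"] index_less[OF assms] by simp
  show "incoming_at E (j, s) \<in> arcs_of_component E j"
    using sub.incoming_at_component[of "(j, s)"] assms by simp
  show "incoming_at D (is ! j, s) \<subseteq> incoming_at E (j, s)"
    using closed_curve.arc_before_mono[OF closed_curve[OF index_less[OF assms]] finite_under under_points_sub] assms
    by simp
qed

lemma merge_outgoing:
  assumes "j < length is" shows "merge (outgoing_at D (is ! j, s)) = outgoing_at E (j, s)"
proof (rule merge_eqI[OF arc_nonempty _ assms])
  show "outgoing_at D (is ! j, s) \<in> arcs_of_component D (is ! j)"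
    using outgoing_at_component[of "(is ! j, s)"] index_less[OF assms] by simp
  show "outgoing_at E (j, s) \<in> arcs_of_component E j"
    using sub.outgoing_at_component[of "(j, s)"] assms by simp
  show "outgoing_at D (is ! j, s) \<subseteq> outgoing_at E (j, s)"
    using closed_curve.arc_after_mono[OF closed_curve[OF index_less[OF assms]] finite_under under_points_sub] assms
    by simp
qed

lemma merge_crossing:
  assumes c: "c \<in> crossings E"
  shows "merge (over_arc D (lift_crossing c)) = over_arc E c"
    "merge (left_arc D (lift_crossing c)) = left_arc E c"
    "merge (right_arc D (lift_crossing c)) = right_arc E c"
proof -
  have l: "fst (fst c) < length is" "fst (snd c) < length is" and cD: "lift_crossing c \<in> crossings D"
    using c unfolding crossings_sub_iff by auto
  show "merge (over_arc D (lift_crossing c)) = over_arc E c"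
    using merge_incoming[OF l(1), of "snd (fst c)"]
    unfolding over_arc_eq(1)[OF cD] sub.over_arc_eq(1)[OF c] by (simp add: lift_crossing_def)
  have "merge (incoming_arc D (lift_crossing c)) = incoming_arc E c"
    using merge_incoming[OF l(2), of "snd (snd c)"]
    unfolding incoming_arc_eq[OF cD] sub.incoming_arc_eq[OF c] by (simp add: lift_crossing_def)
  moreover have "merge (outgoing_arc D (lift_crossing c)) = outgoing_arc E c"
    using merge_outgoing[OF l(2), of "snd (snd c)"]
    unfolding outgoing_arc_eq[OF cD] sub.outgoing_arc_eq[OF c] by (simp add: lift_crossing_def)
  moreover have "under_goes_left D (lift_crossing c) = under_goes_left E c"
    using direction_at_lift[OF l(1)] direction_at_lift[OF l(2)]
    by (simp add: under_goes_left_def lift_crossing_def)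
  ultimately show "merge (left_arc D (lift_crossing c)) = left_arc E c"
    "merge (right_arc D (lift_crossing c)) = right_arc E c"
    by (simp_all add: left_arc_def right_arc_def)
qed

lemma lifted_crossingE:
  assumes "c \<in> crossings D" "fst (fst c) \<in> set is" "fst (snd c) \<in> set is"
  obtains c' where "c' \<in> crossings E" "c = lift_crossing c'"
proof -
  obtain k where k: "k < length is" "fst (fst c) = is ! k" using assms(2) by (metis in_set_conv_nth)
  obtain j where j: "j < length is" "fst (snd c) = is ! j" using assms(3) by (metis in_set_conv_nth)
  have "c = lift_crossing ((k, snd (fst c)), (j, snd (snd c)))"
    using k j by (simp add: lift_crossing_def prod_eq_iff)
  then show ?thesis
    using that[of "((k, snd (fst c)), (j, snd (snd c)))"] assms(1) k j by (simp add: crossings_sub_iff)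
qed

text \<open>
  An underpassing point survives the deletion exactly when the component passing over it is kept:
  as there are no triple points, no other crossing can make it an underpassing point of \<open>E\<close>.
\<close>

lemma under_point_sub_iff:
  assumes c: "c \<in> crossings D" "fst (snd c) \<in> set is"
  shows "point_at D (snd c) \<in> under_points E \<longleftrightarrow> fst (fst c) \<in> set is"
proof
  assume "fst (fst c) \<in> set is"
  then obtain c' where c': "c' \<in> crossings E" "c = lift_crossing c'"
    using lifted_crossingE c by metis
  then have "point_at D (snd c) = point_at E (snd c')"
    using point_at_lift[of "snd c'"] unfolding crossings_sub_iff by (simp add: lift_crossing_def)
  then show "point_at D (snd c) \<in> under_points E"
    using c'(1) by (auto simp: under_points_def)
next
  assume "point_at D (snd c) \<in> under_points E"
  then obtain c' where c': "c' \<in> crossings E" "point_at D (snd c) = point_at E (snd c')"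
    by (auto simp: under_points_def)
  then have l: "lift_crossing c' \<in> crossings D" "point_at D (snd c) = point_at D (snd (lift_crossing c'))"
    using point_at_lift[of "snd c'"] unfolding crossings_sub_iff by (simp_all add: lift_crossing_def)
  then have "c = lift_crossing c'"
    using crossing_point(1)[OF c(1)] crossing_point(1)[OF l(1)] by (intro crossing_eqI[OF c(1) l(1)]) simp
  then show "fst (fst c) \<in> set is"
    using c'(1) unfolding crossings_sub_iff by (auto simp: lift_crossing_def)
qed

lemma merge_dropped_crossing:
  assumes c: "c \<in> crossings D" "fst (snd c) \<in> set is" "fst (fst c) \<notin> set is"
  shows "merge (left_arc D c) = merge (right_arc D c)"
proof -
  obtain j where j: "j < length is" "fst (snd c) = is ! j" using c(2) by (metis in_set_conv_nth)
  let ?s = "snd (snd c)"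
  have "(D ! (is ! j)) ?s \<notin> under_points E"
    using under_point_sub_iff[OF c(1,2)] c(3) j by (simp add: point_at_def)
  then have "incoming_at E (j, ?s) = outgoing_at E (j, ?s)"
    using closed_curve.arc_through(2)[OF closed_curve[OF index_less[OF j(1)]] sub.finite_under] j(1) by simp
  then have "merge (incoming_arc D c) = merge (outgoing_arc D c)"
    using merge_incoming[OF j(1), of ?s] merge_outgoing[OF j(1), of ?s] j(2)
    by (simp add: incoming_arc_eq[OF c(1)] outgoing_arc_eq[OF c(1)])
  then show ?thesis by (simp add: left_arc_def right_arc_def)
qed

sublocale res: laurent_hom "restrict_laurent is" "length D" "length is"
  by (rule laurent_hom_restrict)

text \<open>
  The values on arcs of the projection of Alexander modules that deletes components.
\<close>

definition arc_image :: "arc \<Rightarrow> arc \<Rightarrow>\<^sub>0 laurent"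
  where "arc_image a = (if arc_index D a \<in> set is then Poly_Mapping.single (merge a) 1 else 0)"

lemma arc_image_kept:
  "a \<in> arcs_of_component D i \<Longrightarrow> i \<in> set is \<Longrightarrow> arc_image a = Poly_Mapping.single (merge a) 1"
  using arc_index_eq indices by (auto simp: arc_image_def)

lemma arc_image_dropped:
  "a \<in> arcs_of_component D i \<Longrightarrow> i < length D \<Longrightarrow> i \<notin> set is \<Longrightarrow> arc_image a = 0"
  using arc_index_eq by (auto simp: arc_image_def)

lemma restrict_kept:
  assumes "j < length is"
  shows "restrict_laurent is (laurent_var (is ! j)) = laurent_var j"
    "restrict_laurent is (laurent_var_inv (is ! j)) = laurent_var_inv j"
proof -
  show 1: "restrict_laurent is (laurent_var (is ! j)) = laurent_var j"
    using restrict_laurent_kept[OF distinct assms] .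
  have "laurent_var j * restrict_laurent is (laurent_var_inv (is ! j)) = 1"
    unfolding 1[symmetric] res.mult[symmetric] by (simp add: res.one)
  then have "laurent_var_inv j * (laurent_var j * restrict_laurent is (laurent_var_inv (is ! j))) = laurent_var_inv j"
    by simp
  then show "restrict_laurent is (laurent_var_inv (is ! j)) = laurent_var_inv j"
    by (simp flip: mult.assoc)
qed

lemma restrict_dropped:
  assumes "i \<notin> set is"
  shows "restrict_laurent is (laurent_var i) = 1" "restrict_laurent is (laurent_var_inv i) = 1"
proof -
  show 1: "restrict_laurent is (laurent_var i) = 1"
    using restrict_laurent_dropped[OF assms] .
  have "restrict_laurent is (laurent_var i * laurent_var_inv i) = 1"
    by (simp only: laurent_var_inverse res.one)
  then show "restrict_laurent is (laurent_var_inv i) = 1"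
    unfolding res.mult 1 by simp
qed

text \<open>
  There are three kinds of crossings. Under a deleted component, both terms with underpassing arcs
  vanish and the coefficient of the over arc is \<open>1 - 1\<close>. Where a deleted component passes over a
  kept one, the two underpassing arcs merge and their coefficients cancel. The remaining crossings
  are those of \<open>E\<close>, and their relations go to the relations of \<open>E\<close>.
\<close>

lemma lin_crossing_relation:
  assumes c: "c \<in> crossings D"
  shows "res.lin arc_image (crossing_relation D c) \<in> relations E"
proof -
  note i = crossing_positions[OF c] and ca = crossing_arcs[OF c]
  have eq: "res.lin arc_image (crossing_relation D c) =
      scale (1 - restrict_laurent is (laurent_var (fst (snd c)))) (arc_image (over_arc D c))
      + scale (restrict_laurent is (laurent_var (fst (fst c)))) (arc_image (right_arc D c))
      - arc_image (left_arc D c)"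
    by (simp add: crossing_relation_def additive.add[OF res.additive_lin] additive.diff[OF res.additive_lin]
        res.lin_single res.diff res.one ca)
  consider "fst (snd c) \<notin> set is" | "fst (snd c) \<in> set is" "fst (fst c) \<notin> set is"
    | "fst (snd c) \<in> set is" "fst (fst c) \<in> set is" by blast
  then show ?thesis
  proof cases
    case 1
    then show ?thesis
      using i by (simp add: eq restrict_dropped arc_image_dropped[OF ca(2)] arc_image_dropped[OF ca(3)] relations_zero)
  next
    case 2
    then show ?thesis
      using i merge_dropped_crossing[OF c 2]
      by (simp add: eq restrict_dropped arc_image_dropped[OF ca(1)] arc_image_kept[OF ca(2)]
          arc_image_kept[OF ca(3)] relations_zero)
  next
    case 3
    then obtain c' where c': "c' \<in> crossings E" "c = lift_crossing c'"
      using lifted_crossingE[OF c] by metis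
    have l: "fst (fst c') < length is" "fst (snd c') < length is"
      using c'(1) unfolding crossings_sub_iff by auto
    have idx: "fst (fst c) = is ! fst (fst c')" "fst (snd c) = is ! fst (snd c')"
      using c'(2) by (simp_all add: lift_crossing_def)
    have "res.lin arc_image (crossing_relation D c) = crossing_relation E c'"
      unfolding eq arc_image_kept[OF ca(1) 3(2)] arc_image_kept[OF ca(2) 3(1)] arc_image_kept[OF ca(3) 3(1)]
        idx restrict_kept(1)[OF l(1)] restrict_kept(1)[OF l(2)]
      unfolding c'(2) merge_crossing[OF c'(1)]
      by (simp add: scale_single crossing_relation_def sub.crossing_arcs[OF c'(1)])
    then show ?thesis
      using crossing_relation_in_relations[OF c'(1)] by simp
  qed
qed

lemma lin_relations: "v \<in> relations D \<Longrightarrow> res.lin arc_image v \<in> relations E"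
  by (rule additive_maps_relations[OF res.additive_lin])
    (use res.closed relations_scale lin_crossing_relation in \<open>simp_all add: res.lin_scale\<close>)

definition project :: "alexander_element \<Rightarrow> alexander_element"
  where "project = induced D E (res.lin arc_image)"

lemma project_gamma: "project (gamma D v) = gamma E (res.lin arc_image v)"
  unfolding project_def by (rule induced_gamma[OF res.additive_lin lin_relations])

lemma project_arc_kept:
  assumes "j < length is" "a \<in> arcs_of_component D (is ! j)"
  shows "project (arc_class D a) = arc_class E (merge a)"
  using assms arc_image_kept[OF assms(2)]
  by (simp add: arc_class_def project_gamma res.lin_single res.one)

lemma represents_lin:
  assumes "represents v (is ! j)" "j < length is"
  shows "sub.represents (res.lin arc_image v) j"
proof -
  have v: "v \<in> carrier (arc_module D)" "phi D v = laurent_var (is ! j) - 1"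
    using assms(1) by (simp_all add: represents_def)
  have img: "arc_image a \<in> carrier (arc_module E) \<and>
      phi E (arc_image a) = restrict_laurent is (laurent_var (arc_index D a) - 1)" if "a \<in> arcs D" for a
  proof (cases "arc_index D a \<in> set is")
    case True
    then obtain k where k: "k < length is" "arc_index D a = is ! k" by (metis in_set_conv_nth)
    then have m: "merge a \<in> arcs_of_component E k"
      using that arcs_iff[of a] merge_arc(1) by simp
    then have "merge a \<in> arcs E" "arc_index E (merge a) = k"
      using k(1) sub.arcsI sub.arc_index_eq by simp_all
    then show ?thesis
      using True k by (simp add: arc_image_def free_module_single phi_single res.diff res.one restrict_kept)
  next
    case False
    then show ?thesis
      by (simp add: arc_image_def free_module_zero phi_zero res.diff res.one restrict_dropped)
  qed
  have "res.lin arc_image v \<in> carrier (arc_module E)"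
    using res.lin_carrier[OF v(1), of arc_image "arcs E"] img by simp
  moreover have "phi E (res.lin arc_image v) = laurent_var j - 1"
    using res.phi_lin[OF v(1), of E arc_image] img
    by (simp add: v(2) res.diff res.one restrict_kept[OF assms(2)])
  ultimately show ?thesis
    using assms(2) by (simp add: sub.represents_def)
qed

lemma lin_op:
  "res.lin arc_image (scale (laurent_var j) v - scale (laurent_var i - 1) w)
    = scale (restrict_laurent is (laurent_var j)) (res.lin arc_image v)
      - scale (restrict_laurent is (laurent_var i) - 1) (res.lin arc_image w)"
  by (simp add: additive.diff[OF res.additive_lin] res.lin_scale res.diff res.one)

lemma lin_op_inv:
  "res.lin arc_image (scale (laurent_var_inv j) (v + scale (laurent_var i - 1) w))
    = scale (restrict_laurent is (laurent_var_inv j)) (res.lin arc_image v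
      + scale (restrict_laurent is (laurent_var i) - 1) (res.lin arc_image w))"
  by (simp add: additive.add[OF res.additive_lin] res.lin_scale res.diff res.one)

text \<open>
  An element of a deleted orbit is generated from a deleted arc by actions, and an action
  on 0 contributes a multiple of \<open>t - 1\<close> with \<open>t\<close> specialized to 1.
\<close>

lemma project_dropped:
  assumes "x \<in> orbit i" "i \<notin> set is"
  shows "project x = gamma E 0"
  using assms
proof (induction rule: orbit_induct)
  case (arc a i)
  then show ?case
    using arc_image_dropped[of a i]
    by (simp add: arc_class_def project_gamma res.lin_single res.one)
next
  case (op x y i j)
  obtain v w where *: "x = gamma D v" "represents v i" "y = gamma D w" "represents w j"
    using op.hyps by (elim orbitE) blast
  have "res.lin arc_image v \<in> relations E"
    using op.IH(1)[OF op.prems] by (simp add: *(1) project_gamma gamma_eq_iff)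
  moreover have "restrict_laurent is (laurent_var j) \<in> carrier (laurent_ring (length E))"
    using res.closed[of "laurent_var j"] *(4) by (simp add: represents_def)
  ultimately have "scale (restrict_laurent is (laurent_var j)) (res.lin arc_image v) \<in> relations E"
    by (intro relations_scale)
  then show ?case
    by (simp add: *(1,3) op_gamma(1)[OF *(2,4)] project_gamma gamma_eq_iff lin_op restrict_dropped[OF op.prems])
next
  case (op_inv x y i j)
  obtain v w where *: "x = gamma D v" "represents v i" "y = gamma D w" "represents w j"
    using op_inv.hyps by (elim orbitE) blast
  have "res.lin arc_image v \<in> relations E"
    using op_inv.IH(1)[OF op_inv.prems] by (simp add: *(1) project_gamma gamma_eq_iff)
  moreover have "restrict_laurent is (laurent_var_inv j) \<in> carrier (laurent_ring (length E))"
    using res.closed[of "laurent_var_inv j"] *(4) by (simp add: represents_def)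
  ultimately have "scale (restrict_laurent is (laurent_var_inv j)) (res.lin arc_image v) \<in> relations E"
    by (intro relations_scale)
  then show ?case
    by (simp add: *(1,3) op_inv_gamma(1)[OF *(2,4)] project_gamma gamma_eq_iff lin_op_inv
        restrict_dropped[OF op_inv.prems])
qed

text \<open>
  After projection, the acting element is 0 and the variable of its component is 1.
\<close>

lemma project_op_dropped:
  assumes x: "x \<in> orbit (is ! k)" "k < length is" and y: "y \<in> orbit j" "j \<notin> set is"
  shows "project (alexander_op D x y) = project x" "project (alexander_op_inv D x y) = project x"
proof -
  obtain v w where *: "x = gamma D v" "represents v (is ! k)" "y = gamma D w" "represents w j"
    using x(1) y(1) by (elim orbitE) blast
  have "res.lin arc_image w \<in> relations E"
    using project_dropped[OF y] by (simp add: *(3) project_gamma gamma_eq_iff)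
  moreover have "laurent_var k - 1 \<in> carrier (laurent_ring (length E))"
    using x(2) by simp
  ultimately have "scale (laurent_var k - 1) (res.lin arc_image w) \<in> relations E"
    by (intro relations_scale)
  then show "project (alexander_op D x y) = project x" "project (alexander_op_inv D x y) = project x"
    by (simp_all add: *(1,3) op_gamma(1)[OF *(2,4)] op_inv_gamma(1)[OF *(2,4)] project_gamma gamma_eq_iff
        lin_op lin_op_inv restrict_dropped[OF y(2)] restrict_kept[OF x(2)] relations_uminus)
qed

lemma project_op_kept:
  assumes x: "x \<in> orbit (is ! k)" "k < length is" and y: "y \<in> orbit (is ! j)" "j < length is"
  shows "project (alexander_op D x y) = alexander_op E (project x) (project y)"
    "project (alexander_op_inv D x y) = alexander_op_inv E (project x) (project y)"
proof -
  obtain v w where *: "x = gamma D v" "represents v (is ! k)" "y = gamma D w" "represents w (is ! j)"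
    using x(1) y(1) by (elim orbitE) blast
  have r: "sub.represents (res.lin arc_image v) k" "sub.represents (res.lin arc_image w) j"
    using represents_lin * x(2) y(2) by blast+
  show "project (alexander_op D x y) = alexander_op E (project x) (project y)"
    by (simp add: *(1,3) op_gamma(1)[OF *(2,4)] project_gamma sub.op_gamma(1)[OF r] lin_op
        restrict_kept[OF x(2)] restrict_kept[OF y(2)])
  show "project (alexander_op_inv D x y) = alexander_op_inv E (project x) (project y)"
    by (simp add: *(1,3) op_inv_gamma(1)[OF *(2,4)] project_gamma sub.op_inv_gamma(1)[OF r] lin_op_inv
        restrict_kept[OF x(2)] restrict_kept[OF y(2)])
qed

lemma project_orbit:
  assumes "x \<in> orbit i" "i = is ! k" "k < length is"
  shows "project x \<in> sub.orbit k"
  using assms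
proof (induction arbitrary: k rule: orbit_induct)
  case (arc a i)
  then have "merge a \<in> arcs_of_component E k" "k < length E"
    using merge_arc(1) by simp_all
  then show ?case
    using arc project_arc_kept sub.arc_in_orbit by simp
next
  case (op x y i j)
  show ?case
  proof (cases "j \<in> set is")
    case True
    then obtain l where l: "l < length is" "j = is ! l" by (metis in_set_conv_nth)
    then show ?thesis
      using op project_op_kept(1)[of x k y l] sub.op_in_orbit[OF op.IH(1) op.IH(2)] by simp
  next
    case False
    then show ?thesis using op project_op_dropped(1)[of x k y j] by simp
  qed
next
  case (op_inv x y i j)
  show ?case
  proof (cases "j \<in> set is")
    case True
    then obtain l where l: "l < length is" "j = is ! l" by (metis in_set_conv_nth)
    then show ?thesis
      using op_inv project_op_kept(2)[of x k y l] sub.op_inv_in_orbit[OF op_inv.IH(1) op_inv.IH(2)] by simp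
  next
    case False
    then show ?thesis using op_inv project_op_dropped(2)[of x k y j] by simp
  qed
qed

end

section \<open>Comparing sublinks\<close>

text \<open>
  The hypotheses are those consequences of compatible indexing that involve only \<open>f\<close>, so that they hold
  equally for the inverse of an isomorphism, with the roles of \<open>D\<close> and \<open>D'\<close> exchanged.
\<close>

locale sublink_comparison = source: subdiagram D "is" + target: subdiagram D' is' for D "is" D' is' +
  fixes f :: "alexander_element \<Rightarrow> alexander_element"
  assumes same_length: "length is = length is'"
    and f_op: "x \<in> alexander_set D \<Longrightarrow> y \<in> alexander_set D \<Longrightarrow>
      f (alexander_op D x y) = alexander_op D' (f x) (f y)"
    and f_op_inv: "x \<in> alexander_set D \<Longrightarrow> y \<in> alexander_set D \<Longrightarrow>
      f (alexander_op_inv D x y) = alexander_op_inv D' (f x) (f y)"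
    and f_kept: "j < length is \<Longrightarrow> x \<in> source.orbit (is ! j) \<Longrightarrow> f x \<in> target.orbit (is' ! j)"
    and f_dropped: "x \<in> source.orbit i \<Longrightarrow> i \<notin> set is \<Longrightarrow> \<exists>i'. i' \<notin> set is' \<and> f x \<in> target.orbit i'"
begin

abbreviation "E \<equiv> source.E"
abbreviation "E' \<equiv> target.E"

definition transfer :: "alexander_element \<Rightarrow> alexander_element"
  where "transfer x = target.project (f x)"

lemma transfer_orbit: "x \<in> source.orbit (is ! j) \<Longrightarrow> j < length is \<Longrightarrow> transfer x \<in> target.sub.orbit j"
  unfolding transfer_def using target.project_orbit[OF f_kept] same_length by simp

lemma transfer_op_kept:
  assumes x: "x \<in> source.orbit (is ! k)" "k < length is" and y: "y \<in> source.orbit (is ! j)" "j < length is"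
  shows "transfer (alexander_op D x y) = alexander_op E' (transfer x) (transfer y)"
    "transfer (alexander_op_inv D x y) = alexander_op_inv E' (transfer x) (transfer y)"
  unfolding transfer_def
  using target.project_op_kept[OF f_kept[OF x(2,1)] _ f_kept[OF y(2,1)]] x(2) y(2) same_length
    f_op[OF source.orbit_subset[OF x(1)] source.orbit_subset[OF y(1)]]
    f_op_inv[OF source.orbit_subset[OF x(1)] source.orbit_subset[OF y(1)]]
  by simp_all

lemma transfer_op_dropped:
  assumes x: "x \<in> source.orbit (is ! k)" "k < length is" and y: "y \<in> source.orbit j" "j \<notin> set is"
  shows "transfer (alexander_op D x y) = transfer x"
    "transfer (alexander_op_inv D x y) = transfer x"
proof -
  obtain j' where "j' \<notin> set is'" "f y \<in> target.orbit j'"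
    using f_dropped[OF y] by blast
  then show "transfer (alexander_op D x y) = transfer x" "transfer (alexander_op_inv D x y) = transfer x"
    unfolding transfer_def
    using target.project_op_dropped[OF f_kept[OF x(2,1)]] x(2) same_length
      f_op[OF source.orbit_subset[OF x(1)] source.orbit_subset[OF y(1)]]
      f_op_inv[OF source.orbit_subset[OF x(1)] source.orbit_subset[OF y(1)]]
    by simp_all
qed

text \<open>
  Two arcs of \<open>D\<close> inside one arc of \<open>E\<close> are separated by crossings at which a deleted component
  passes over. There the left arc is the right arc acted upon by an element of a deleted orbit, and
  \<open>f\<close> sends that element to a deleted orbit of \<open>D'\<close>, whose action is trivial after projection.
\<close>

lemma transfer_merge:
  assumes j: "j < length is" and a: "a \<in> arcs_of_component D (is ! j)" "a' \<in> arcs_of_component D (is ! j)"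
    and eq: "source.merge a = source.merge a'"
  shows "transfer (arc_class D a) = transfer (arc_class D a')"
proof (rule source.arcs_glued[OF source.index_less[OF j] source.under_points_sub, where h = "\<lambda>a. transfer (arc_class D a)"])
  show "source.merge a \<in> components (range (D ! (is ! j)) - under_points E)"
    using source.merge_arc(1)[OF j a(1)] j by (simp add: arcs_of_component_def)
  show "a \<in> arcs_of_component D (is ! j)" "a' \<in> arcs_of_component D (is ! j)"
    "a \<subseteq> source.merge a" "a' \<subseteq> source.merge a"
    using a source.merge_arc(2)[OF j] eq by auto
  fix c assume c: "c \<in> crossings D" "fst (snd c) = is ! j" "point_at D (snd c) \<notin> under_points E"
  have under: "fst (snd c) \<in> set is" using c(2) j by simp
  have over: "fst (fst c) \<notin> set is"
    using source.under_point_sub_iff[OF c(1) under] c(3) by simp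
  note ca = source.crossing_arcs[OF c(1)] and i = source.crossing_positions[OF c(1)]
  have "arc_class D (right_arc D c) \<in> source.orbit (is ! j)"
    "arc_class D (over_arc D c) \<in> source.orbit (fst (fst c))"
    using source.arc_in_orbit ca(1,3) i c(2) by metis+
  from transfer_op_dropped(1)[OF this(1) j this(2) over]
  show "transfer (arc_class D (left_arc D c)) = transfer (arc_class D (right_arc D c))"
    by (simp add: source.crossing_op[OF c(1)])
qed

text \<open>
  A representative of the common value of \<open>transfer\<close> at the arcs of \<open>D\<close> inside the arc \<open>b\<close> of \<open>E\<close>.
\<close>

definition arc_lift :: "arc \<Rightarrow> arc \<Rightarrow>\<^sub>0 laurent"
  where "arc_lift b = (SOME v. \<exists>j a. j < length is \<and> a \<in> arcs_of_component D (is ! j) \<and> source.merge a = b \<and>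
    target.sub.represents v j \<and> gamma E' v = transfer (arc_class D a))"

lemma arc_lift_merge:
  assumes j: "j < length is" and a: "a \<in> arcs_of_component D (is ! j)"
  shows "target.sub.represents (arc_lift (source.merge a)) j"
    "gamma E' (arc_lift (source.merge a)) = transfer (arc_class D a)"
proof -
  let ?P = "\<lambda>v. \<exists>k a'. k < length is \<and> a' \<in> arcs_of_component D (is ! k) \<and> source.merge a' = source.merge a \<and>
    target.sub.represents v k \<and> gamma E' v = transfer (arc_class D a')"
  have "transfer (arc_class D a) \<in> target.sub.orbit j"
    using transfer_orbit[OF source.arc_in_orbit[OF a source.index_less[OF j]] j] .
  then obtain v where "transfer (arc_class D a) = gamma E' v" "target.sub.represents v j"
    by (elim target.sub.orbitE) blast
  then have "?P v" using j a by metis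
  then have "?P (arc_lift (source.merge a))"
    unfolding arc_lift_def by (rule someI[of ?P])
  then obtain k a' where k: "k < length is" and a': "a' \<in> arcs_of_component D (is ! k)"
    "source.merge a' = source.merge a"
    and lift: "target.sub.represents (arc_lift (source.merge a)) k"
      "gamma E' (arc_lift (source.merge a)) = transfer (arc_class D a')" by blast
  have "arc_index E (source.merge a) = j" "arc_index E (source.merge a) = k"
    using source.sub.arc_index_eq[OF source.merge_arc(1)[OF j a]]
      source.sub.arc_index_eq[OF source.merge_arc(1)[OF k a'(1)]] a'(2) j k by simp_all
  then have "k = j" by simp
  with lift show "target.sub.represents (arc_lift (source.merge a)) j"
    "gamma E' (arc_lift (source.merge a)) = transfer (arc_class D a)"
    using transfer_merge[OF j a, of a'] a' by simp_all
qed

lemma represents_arc_lift: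
  assumes "b \<in> arcs_of_component E j" "j < length is"
  shows "target.sub.represents (arc_lift b) j"
proof -
  obtain a where "a \<in> arcs_of_component D (is ! j)" "source.merge a = b"
    using source.merge_surj[OF assms(2,1)] .
  then show ?thesis using arc_lift_merge(1)[OF assms(2)] by blast
qed

sublocale id: laurent_hom "\<lambda>p. p" "length E" "length E'"
  using same_length by unfold_locales auto

text \<open>
  A crossing of \<open>E\<close> is a crossing of \<open>D\<close>, where \<open>crossing_op\<close> applies; \<open>transfer\<close> preserves this
  equation of quandle elements, which in the module of \<open>E'\<close> is the linear relation again.
\<close>

lemma lin_crossing_relation:
  assumes c: "c \<in> crossings E"
  shows "id.lin arc_lift (crossing_relation E c) \<in> relations E'"
proof -
  define d where "d = source.lift_crossing c"
  have l: "fst (fst c) < length is" "fst (snd c) < length is" and d: "d \<in> crossings D"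
    using c unfolding source.crossings_sub_iff d_def by auto
  have idx: "fst (fst d) = is ! fst (fst c)" "fst (snd d) = is ! fst (snd c)"
    by (simp_all add: d_def source.lift_crossing_def)
  note ca = source.crossing_arcs[OF d, unfolded idx]
  note m = source.merge_crossing[OF c, folded d_def]
  note over = arc_lift_merge[OF l(1) ca(1), unfolded m]
    and left = arc_lift_merge[OF l(2) ca(2), unfolded m]
    and right = arc_lift_merge[OF l(2) ca(3), unfolded m]
  have "arc_class D (right_arc D d) \<in> source.orbit (is ! fst (snd c))"
    "arc_class D (over_arc D d) \<in> source.orbit (is ! fst (fst c))"
    using source.arc_in_orbit ca(1,3) source.index_less l by blast+
  from transfer_op_kept(1)[OF this(1) l(2) this(2) l(1)]
  have "gamma E' (arc_lift (left_arc E c))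
      = alexander_op E' (gamma E' (arc_lift (right_arc E c))) (gamma E' (arc_lift (over_arc E c)))"
    by (simp add: left right over source.crossing_op[OF d])
  also have "\<dots> = gamma E' (scale (laurent_var (fst (fst c))) (arc_lift (right_arc E c))
      - scale (laurent_var (fst (snd c)) - 1) (arc_lift (over_arc E c)))"
    by (rule target.sub.op_gamma(1)[OF right(1) over(1)])
  finally have "scale (laurent_var (fst (fst c))) (arc_lift (right_arc E c))
      - scale (laurent_var (fst (snd c)) - 1) (arc_lift (over_arc E c)) - arc_lift (left_arc E c) \<in> relations E'"
    by (metis gamma_eq_iff)
  also have "scale (laurent_var (fst (fst c))) (arc_lift (right_arc E c))
      - scale (laurent_var (fst (snd c)) - 1) (arc_lift (over_arc E c)) - arc_lift (left_arc E c)
      = id.lin arc_lift (crossing_relation E c)"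
    by (simp add: crossing_relation_def additive.add[OF id.additive_lin] additive.diff[OF id.additive_lin]
        id.lin_single source.sub.crossing_arcs[OF c] scaling.scale_left_diff_distrib)
  finally show ?thesis .
qed

lemma lin_relations: "v \<in> relations E \<Longrightarrow> id.lin arc_lift v \<in> relations E'"
  by (rule additive_maps_relations[OF id.additive_lin])
    (use relations_scale lin_crossing_relation same_length in \<open>simp_all add: id.lin_scale\<close>)

definition comparison :: "alexander_element \<Rightarrow> alexander_element"
  where "comparison = induced E E' (id.lin arc_lift)"

lemma comparison_gamma: "comparison (gamma E v) = gamma E' (id.lin arc_lift v)"
  unfolding comparison_def by (rule induced_gamma[OF id.additive_lin lin_relations])

lemma represents_lin:
  assumes "source.sub.represents v j"
  shows "target.sub.represents (id.lin arc_lift v) j"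
proof -
  have v: "v \<in> carrier (arc_module E)" "phi E v = laurent_var j - 1" "j < length E"
    using assms by (simp_all add: source.sub.represents_def)
  have img: "arc_lift b \<in> carrier (arc_module E') \<and> phi E' (arc_lift b) = laurent_var (arc_index E b) - 1"
    if "b \<in> arcs E" for b
    using represents_arc_lift[of b "arc_index E b"] that source.sub.arcs_iff[of b]
    by (simp add: target.sub.represents_def)
  have "id.lin arc_lift v \<in> carrier (arc_module E')"
    using id.lin_carrier[OF v(1), of arc_lift "arcs E'"] img by simp
  moreover have "phi E' (id.lin arc_lift v) = laurent_var j - 1"
    using id.phi_lin[OF v(1), of E' arc_lift] img by (simp add: v(2))
  ultimately show ?thesis
    using v(3) same_length by (simp add: target.sub.represents_def)
qed

lemma comparison_op:
  assumes "x \<in> source.sub.orbit i" "y \<in> source.sub.orbit j"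
  shows "comparison (alexander_op E x y) = alexander_op E' (comparison x) (comparison y)"
    "comparison (alexander_op_inv E x y) = alexander_op_inv E' (comparison x) (comparison y)"
proof -
  obtain v w where *: "x = gamma E v" "source.sub.represents v i" "y = gamma E w" "source.sub.represents w j"
    using assms by (elim source.sub.orbitE) blast
  note r = represents_lin[OF *(2)] represents_lin[OF *(4)]
  show "comparison (alexander_op E x y) = alexander_op E' (comparison x) (comparison y)"
    by (simp add: *(1,3) source.sub.op_gamma(1)[OF *(2,4)] comparison_gamma target.sub.op_gamma(1)[OF r]
        additive.diff[OF id.additive_lin] id.lin_scale)
  show "comparison (alexander_op_inv E x y) = alexander_op_inv E' (comparison x) (comparison y)"
    by (simp add: *(1,3) source.sub.op_inv_gamma(1)[OF *(2,4)] comparison_gamma target.sub.op_inv_gamma(1)[OF r]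
        additive.add[OF id.additive_lin] id.lin_scale)
qed

lemma comparison_arc:
  assumes "j < length is" "a \<in> arcs_of_component D (is ! j)"
  shows "comparison (arc_class E (source.merge a)) = transfer (arc_class D a)"
  unfolding arc_class_def[of E] comparison_gamma
  using arc_lift_merge(2)[OF assms] by (simp add: id.lin_single)

lemma comparison_orbit:
  assumes "x \<in> source.sub.orbit j" shows "comparison x \<in> target.sub.orbit j"
  using assms
proof (induction rule: source.sub.orbit_induct)
  case (arc b j)
  then have j: "j < length is" by simp
  obtain a where a: "a \<in> arcs_of_component D (is ! j)" "source.merge a = b"
    using source.merge_surj[OF j arc(2)] .
  have "transfer (arc_class D a) \<in> target.sub.orbit j"
    using transfer_orbit[OF source.arc_in_orbit[OF a(1) source.index_less[OF j]] j] .
  then show ?case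
    using comparison_arc[OF j a(1)] a(2) by simp
next
  case (op x y i j)
  then show ?case by (simp add: comparison_op(1)[OF op.hyps] target.sub.op_in_orbit)
next
  case (op_inv x y i j)
  then show ?case by (simp add: comparison_op(2)[OF op_inv.hyps] target.sub.op_inv_in_orbit)
qed

text \<open>
  The square formed by the two projections, \<open>f\<close> and \<open>comparison\<close> commutes on kept orbits.
\<close>

lemma comparison_project:
  assumes "x \<in> source.orbit i" "i = is ! k" "k < length is"
  shows "comparison (source.project x) = transfer x"
  using assms
proof (induction arbitrary: k rule: source.orbit_induct)
  case (arc a i)
  then show ?case
    using source.project_arc_kept comparison_arc by simp
next
  case (op x y i j)
  note x = op.hyps(1)[unfolded op.prems(1)]
  show ?case
  proof (cases "j \<in> set is")
    case True
    then obtain l where l: "l < length is" "j = is ! l" by (metis in_set_conv_nth)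
    note y = op.hyps(2)[unfolded l(2)]
    show ?thesis
      using op.IH(1)[OF op.prems] op.IH(2)[OF l(2,1)]
      by (simp add: source.project_op_kept(1)[OF x op.prems(2) y l(1)] transfer_op_kept(1)[OF x op.prems(2) y l(1)]
          comparison_op(1)[OF source.project_orbit[OF x refl op.prems(2)] source.project_orbit[OF y refl l(1)]])
  next
    case False
    show ?thesis
      using op.IH(1)[OF op.prems]
      by (simp add: source.project_op_dropped(1)[OF x op.prems(2) op.hyps(2) False]
          transfer_op_dropped(1)[OF x op.prems(2) op.hyps(2) False])
  qed
next
  case (op_inv x y i j)
  note x = op_inv.hyps(1)[unfolded op_inv.prems(1)]
  show ?case
  proof (cases "j \<in> set is")
    case True
    then obtain l where l: "l < length is" "j = is ! l" by (metis in_set_conv_nth)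
    note y = op_inv.hyps(2)[unfolded l(2)]
    show ?thesis
      using op_inv.IH(1)[OF op_inv.prems] op_inv.IH(2)[OF l(2,1)]
      by (simp add: source.project_op_kept(2)[OF x op_inv.prems(2) y l(1)] transfer_op_kept(2)[OF x op_inv.prems(2) y l(1)]
          comparison_op(2)[OF source.project_orbit[OF x refl op_inv.prems(2)] source.project_orbit[OF y refl l(1)]])
  next
    case False
    show ?thesis
      using op_inv.IH(1)[OF op_inv.prems]
      by (simp add: source.project_op_dropped(2)[OF x op_inv.prems(2) op_inv.hyps(2) False]
          transfer_op_dropped(2)[OF x op_inv.prems(2) op_inv.hyps(2) False])
  qed
qed

end

text \<open>
  Since both maps preserve the operations, the arcs of \<open>E\<close> suffice. An arc of \<open>E\<close> is the projection
  of an arc \<open>a\<close> of \<open>D\<close>, and the commuting squares for \<open>f\<close> and for \<open>g\<close> lead from it to the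
  projection of \<open>g (f a)\<close>.
\<close>

lemma comparison_inverse:
  assumes fg: "sublink_comparison D is D' is' f" and gf: "sublink_comparison D' is' D is g"
    and inverse: "\<And>x. x \<in> alexander_set D \<Longrightarrow> g (f x) = x"
    and x: "x \<in> alexander_set (map ((!) D) is)"
  shows "sublink_comparison.comparison D' is' D is g (sublink_comparison.comparison D is D' is' f x) = x"
proof -
  interpret F: sublink_comparison D "is" D' is' f by fact
  interpret G: sublink_comparison D' is' D "is" g by fact
  obtain i where "x \<in> F.source.sub.orbit i"
    using F.source.sub.in_some_orbit[OF x] by metis
  then show ?thesis
  proof (induction rule: F.source.sub.orbit_induct)
    case (arc b j)
    then have j: "j < length is" by simp
    then have j': "j < length is'" using F.same_length by simp
    obtain a where a: "a \<in> arcs_of_component D (is ! j)" "F.source.merge a = b"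
      using F.source.merge_surj[OF j arc(2)] .
    have aD: "arc_class D a \<in> F.source.orbit (is ! j)"
      using F.source.arc_in_orbit[OF a(1) F.source.index_less[OF j]] .
    have "F.comparison (arc_class F.E b) = F.target.project (f (arc_class D a))"
      using F.comparison_arc[OF j a(1)] a(2) by (simp add: F.transfer_def)
    then have "G.comparison (F.comparison (arc_class F.E b)) = G.transfer (f (arc_class D a))"
      using G.comparison_project[OF F.f_kept[OF j aD] refl j'] by simp
    also have "\<dots> = F.source.project (arc_class D a)"
      using inverse F.source.orbit_subset[OF aD] by (simp add: G.transfer_def)
    also have "\<dots> = arc_class F.E b"
      using F.source.project_arc_kept[OF j a(1)] a(2) by simp
    finally show ?case .
  next
    case (op x y i j)
    then show ?case
      by (simp add: F.comparison_op(1)[OF op.hyps]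
          G.comparison_op(1)[OF F.comparison_orbit[OF op.hyps(1)] F.comparison_orbit[OF op.hyps(2)]])
  next
    case (op_inv x y i j)
    then show ?case
      by (simp add: F.comparison_op(2)[OF op_inv.hyps]
          G.comparison_op(2)[OF F.comparison_orbit[OF op_inv.hyps(1)] F.comparison_orbit[OF op_inv.hyps(2)]])
  qed
qed

lemma comparison_iso:
  assumes fg: "sublink_comparison D is D' is' f" and gf: "sublink_comparison D' is' D is g"
    and "\<And>x. x \<in> alexander_set D \<Longrightarrow> g (f x) = x" "\<And>y. y \<in> alexander_set D' \<Longrightarrow> f (g y) = y"
  shows "quandle_isomorphic (alexander_quandle (map ((!) D) is)) (alexander_quandle (map ((!) D') is'))"
proof -
  interpret F: sublink_comparison D "is" D' is' f by fact
  interpret G: sublink_comparison D' is' D "is" g by fact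
  have "F.comparison x \<in> alexander_set F.E'" if "x \<in> alexander_set F.E" for x
    using F.source.sub.in_some_orbit[OF that] F.comparison_orbit F.target.sub.orbit_subset by metis
  moreover have "G.comparison x \<in> alexander_set F.E" if "x \<in> alexander_set F.E'" for x
    using F.target.sub.in_some_orbit[OF that] G.comparison_orbit F.source.sub.orbit_subset by metis
  ultimately have "bij_betw F.comparison (alexander_set F.E) (alexander_set F.E')"
    using comparison_inverse[OF fg gf assms(3)] comparison_inverse[OF gf fg assms(4)]
    by (intro bij_betw_byWitness[where f' = G.comparison]) auto
  moreover have "F.comparison (alexander_op F.E x y) = alexander_op F.E' (F.comparison x) (F.comparison y)"
    "F.comparison (alexander_op_inv F.E x y) = alexander_op_inv F.E' (F.comparison x) (F.comparison y)"
    if xy: "x \<in> alexander_set F.E" "y \<in> alexander_set F.E" for x y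
  proof -
    obtain i j where "x \<in> F.source.sub.orbit i" "y \<in> F.source.sub.orbit j"
      using F.source.sub.in_some_orbit xy by metis
    then show "F.comparison (alexander_op F.E x y) = alexander_op F.E' (F.comparison x) (F.comparison y)"
      "F.comparison (alexander_op_inv F.E x y) = alexander_op_inv F.E' (F.comparison x) (F.comparison y)"
      using F.comparison_op by blast+
  qed
  ultimately have "F.comparison \<in> quandle_isos (alexander_quandle F.E) (alexander_quandle F.E')"
    by (simp add: quandle_isos_def alexander_quandle_def)
  then show ?thesis unfolding quandle_isomorphic_def by blast
qed

section \<open>Orbits under isomorphisms\<close>

text \<open>
  The type of quandles imposes no axioms. Closure is what makes the inverse of an isomorphism
  an isomorphism: an operation applied to images is the image of a member of the carrier.
\<close>

definition closed_quandle :: "'a quandle \<Rightarrow> bool"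
  where "closed_quandle Q \<longleftrightarrow> (\<forall>x\<in>carrier Q. \<forall>y\<in>carrier Q. x \<triangleright>\<^bsub>Q\<^esub> y \<in> carrier Q \<and> x \<triangleleft>\<^bsub>Q\<^esub> y \<in> carrier Q)"

lemma (in diagram) closed_alexander_quandle: "closed_quandle (alexander_quandle D)"
proof -
  have "alexander_op D x y \<in> alexander_set D \<and> alexander_op_inv D x y \<in> alexander_set D"
    if "x \<in> alexander_set D" "y \<in> alexander_set D" for x y
    using that op_in_orbit op_inv_in_orbit in_some_orbit orbit_subset by metis
  then show ?thesis by (simp add: closed_quandle_def alexander_quandle_def)
qed

lemma quandle_isos_inverse:
  assumes Q: "closed_quandle Q" and f: "f \<in> quandle_isos Q R"
  shows "inv_into (carrier Q) f \<in> quandle_isos R Q"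
proof -
  let ?g = "inv_into (carrier Q) f"
  have bij: "bij_betw f (carrier Q) (carrier R)" using f by (simp add: quandle_isos_def)
  have "?g (u \<triangleright>\<^bsub>R\<^esub> v) = ?g u \<triangleright>\<^bsub>Q\<^esub> ?g v \<and> ?g (u \<triangleleft>\<^bsub>R\<^esub> v) = ?g u \<triangleleft>\<^bsub>Q\<^esub> ?g v"
    if uv: "u \<in> carrier R" "v \<in> carrier R" for u v
  proof -
    obtain x y where x: "x \<in> carrier Q" "u = f x" and y: "y \<in> carrier Q" "v = f y"
      using bij uv by (metis bij_betw_imp_surj_on imageE)
    have "u \<triangleright>\<^bsub>R\<^esub> v = f (x \<triangleright>\<^bsub>Q\<^esub> y)" "u \<triangleleft>\<^bsub>R\<^esub> v = f (x \<triangleleft>\<^bsub>Q\<^esub> y)"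
      using f x y by (simp_all add: quandle_isos_def)
    moreover have "x \<triangleright>\<^bsub>Q\<^esub> y \<in> carrier Q" "x \<triangleleft>\<^bsub>Q\<^esub> y \<in> carrier Q"
      using Q x y by (simp_all add: closed_quandle_def)
    ultimately show ?thesis
      using x y bij by (simp add: bij_betw_inv_into_left)
  qed
  then show ?thesis
    using bij_betw_inv_into[OF bij] by (simp add: quandle_isos_def)
qed

lemma stable_subset_image:
  assumes f: "f \<in> quandle_isos Q R" and X: "stable_subset Q X"
  shows "stable_subset R (f ` X)"
proof -
  have img: "f ` carrier Q = carrier R"
    using f by (simp add: quandle_isos_def bij_betw_def)
  have "f x \<triangleright>\<^bsub>R\<^esub> v \<in> f ` X \<and> f x \<triangleleft>\<^bsub>R\<^esub> v \<in> f ` X" if "x \<in> X" "v \<in> carrier R" for x v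
  proof -
    obtain y where y: "y \<in> carrier Q" "v = f y" using img \<open>v \<in> carrier R\<close> by blast
    moreover have "x \<in> carrier Q" using X \<open>x \<in> X\<close> by (auto simp: stable_subset_def)
    ultimately have "f x \<triangleright>\<^bsub>R\<^esub> v = f (x \<triangleright>\<^bsub>Q\<^esub> y)" "f x \<triangleleft>\<^bsub>R\<^esub> v = f (x \<triangleleft>\<^bsub>Q\<^esub> y)"
      using f by (simp_all add: quandle_isos_def)
    then show ?thesis using X \<open>x \<in> X\<close> y(1) by (simp add: stable_subset_def)
  qed
  moreover have "f ` X \<subseteq> carrier R" "f ` X \<noteq> {}"
    using X img by (auto simp: stable_subset_def)
  ultimately show ?thesis by (auto simp: stable_subset_def)
qed

lemma quandle_orbits_image:
  assumes Q: "closed_quandle Q" and f: "f \<in> quandle_isos Q R" and X: "X \<in> quandle_orbits Q"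
  shows "f ` X \<in> quandle_orbits R"
proof -
  let ?g = "inv_into (carrier Q) f"
  have bij: "bij_betw f (carrier Q) (carrier R)" using f by (simp add: quandle_isos_def)
  have st: "stable_subset Q X" and min: "\<And>Y. stable_subset Q Y \<Longrightarrow> Y \<subseteq> X \<Longrightarrow> Y = X"
    using X by (auto simp: quandle_orbits_def)
  then have Xc: "X \<subseteq> carrier Q" by (simp add: stable_subset_def)
  have inv: "?g ` f ` X = X"
    using bij Xc by (simp add: bij_betw_imp_inj_on)
  have "Y = f ` X" if Y: "stable_subset R Y" "Y \<subseteq> f ` X" for Y
  proof -
    have "stable_subset Q (?g ` Y)"
      using stable_subset_image[OF quandle_isos_inverse[OF Q f] Y(1)] .
    moreover have "?g ` Y \<subseteq> X" using Y(2) inv by blast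
    ultimately have "?g ` Y = X" by (rule min)
    then have "f ` ?g ` Y = f ` X" by simp
    moreover have "f ` ?g ` Y = Y"
      using image_inv_into_cancel[OF bij_betw_imp_surj_on[OF bij]] Y(1) by (simp add: stable_subset_def)
    ultimately show ?thesis by simp
  qed
  then show ?thesis
    using stable_subset_image[OF f st] by (simp add: quandle_orbits_def)
qed

lemma quandle_orbits_bij:
  assumes Q: "closed_quandle Q" and R: "closed_quandle R" and f: "f \<in> quandle_isos Q R"
  shows "bij_betw ((`) f) (quandle_orbits Q) (quandle_orbits R)"
proof -
  let ?g = "inv_into (carrier Q) f"
  have bij: "bij_betw f (carrier Q) (carrier R)" using f by (simp add: quandle_isos_def)
  have sub: "X \<subseteq> carrier S" if "X \<in> quandle_orbits S" for X and S :: "'c quandle"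
    using that by (simp add: quandle_orbits_def stable_subset_def)
  have g: "?g \<in> quandle_isos R Q" using quandle_isos_inverse[OF Q f] .
  show ?thesis
  proof (rule bij_betw_byWitness[where f' = "(`) ?g"])
    show "\<forall>X\<in>quandle_orbits Q. ?g ` f ` X = X"
      using sub inv_into_image_cancel[OF bij_betw_imp_inj_on[OF bij]] by blast
    show "\<forall>Y\<in>quandle_orbits R. f ` ?g ` Y = Y"
      using sub image_inv_into_cancel[OF bij_betw_imp_surj_on[OF bij]] by blast
    show "(`) f ` quandle_orbits Q \<subseteq> quandle_orbits R" "(`) ?g ` quandle_orbits R \<subseteq> quandle_orbits Q"
      using quandle_orbits_image[OF Q f] quandle_orbits_image[OF R g] by blast+
  qed
qed

text \<open>
  The orbits of both quandles are indexed bijectively by the components, so \<open>f\<close> induces a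
  bijection \<open>g\<close> between the index sets; keeping the indices of \<open>D\<close>, those of \<open>D'\<close> are permuted by \<open>g\<close>.
\<close>

lemma compatible_reindexing_exists:
  assumes "regular_diagram D" "regular_diagram D'"
    and f: "f \<in> quandle_isos (alexander_quandle D) (alexander_quandle D')"
  shows "length D = length D'" "\<exists>\<pi> \<pi>'. compatible_reindexing D D' f \<pi> \<pi>'"
proof -
  interpret D: diagram D by unfold_locales fact
  interpret D': diagram D' by unfold_locales fact
  let ?n = "length D"
  have b: "bij_betw D.orbit {..<?n} (quandle_orbits (alexander_quandle D))"
    "bij_betw D'.orbit {..<length D'} (quandle_orbits (alexander_quandle D'))"
    using D.inj_orbit D'.inj_orbit by (simp_all add: bij_betw_def D.quandle_orbits_eq D'.quandle_orbits_eq)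
  define g where "g = inv_into {..<length D'} D'.orbit \<circ> (`) f \<circ> D.orbit"
  have g: "bij_betw g {..<?n} {..<length D'}"
    unfolding g_def
    using b(1) quandle_orbits_bij[OF D.closed_alexander_quandle D'.closed_alexander_quandle f] bij_betw_inv_into[OF b(2)]
    by (intro bij_betw_trans)
  then show len: "length D = length D'"
    using bij_betw_same_card by fastforce
  have orb: "f ` D.orbit i = D'.orbit (g i)" if "i < ?n" for i
  proof -
    have "f ` D.orbit i \<in> quandle_orbits (alexander_quandle D')"
      using quandle_orbits_image[OF D.closed_alexander_quandle f] that D.quandle_orbits_eq by blast
    then show ?thesis
      using b(2) by (simp add: g_def bij_betw_inv_into_right)
  qed
  \<comment> \<open>A permutation of \<open>{..<n}\<close> is a function on all natural numbers that fixes those outside.\<close>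
  define \<pi>' where "\<pi>' = (\<lambda>i. if i < ?n then g i else i)"
  have "bij_betw \<pi>' {..<?n} {..<?n}"
    using g len by (subst bij_betw_cong[of _ _ g]) (simp_all add: \<pi>'_def)
  then have "\<pi>' permutes {..<?n}"
    by (rule bij_imp_permutes) (simp add: \<pi>'_def)
  moreover have "f ` component_orbit D i = component_orbit D' (\<pi>' i)" if i: "i < ?n" for i
  proof -
    have "g i < length D'" using g i bij_betwE by blast
    then show ?thesis
      using i orb D.component_orbit_eq D'.component_orbit_eq by (simp add: \<pi>'_def)
  qed
  ultimately have "compatible_reindexing D D' f id \<pi>'"
    using len by (simp add: compatible_reindexing_def)
  then show "\<exists>\<pi> \<pi>'. compatible_reindexing D D' f \<pi> \<pi>'" by blast
qed

section \<open>Sublinks of re-indexed links\<close>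

lemma sublink_reindex:
  assumes "\<pi> permutes {..<length L}"
  shows "sublink (reindex \<pi> L) S = map ((!) L) (map \<pi> (nths [0..<length L] S))"
  by (simp add: sublink_def reindex_def permute_list_def nths_map)

text \<open>The ambient isotopy for the whole link also moves each sublink.\<close>

lemma diagram_of_sublink:
  assumes DL: "diagram_of D L" and "distinct is" "set is \<subseteq> {..<length L}"
  shows "diagram_of (map ((!) D) is) (map ((!) L) is)"
proof -
  have len: "length D = length L" using DL by (simp add: diagram_of_def ambient_isotopic_def in_S3_def)
  interpret subdiagram D "is"
    using assms len by unfold_locales (simp_all add: diagram_of_def)
  obtain H :: "real \<times> sphere3 \<Rightarrow> sphere3" where H:
    "continuous_map (prod_topology (top_of_set {0..1}) S3) S3 H"
    "\<forall>u\<in>{0..1}. homeomorphic_map S3 S3 (\<lambda>x. H (u, x))"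
    "\<forall>x\<in>topspace S3. H (0, x) = x"
    "\<forall>i<length D. \<forall>s. H (1, (in_S3 D ! i) s) = (L ! i) s"
    using DL by (auto simp: diagram_of_def ambient_isotopic_def in_S3_def)
  have "H (1, (in_S3 E ! i) s) = (map ((!) L) is ! i) s" if "i < length is" for i s
    using H(4) index_less[OF that] that by (simp add: in_S3_def)
  then have "ambient_isotopic (in_S3 E) (map ((!) L) is)"
    unfolding ambient_isotopic_def using H(1-3) by (auto simp: in_S3_def)
  then show ?thesis
    using regular_sub by (simp add: diagram_of_def)
qed

text \<open>
  A deleted orbit has an index \<open>\<pi> k\<close> with \<open>k\<close> outside of \<open>ks\<close>, and \<open>f\<close> sends it to the orbit with index \<open>\<pi>' k\<close>,
  which is deleted too because \<open>\<pi>'\<close> is injective.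
\<close>

lemma sublink_comparison_of_reindexing:
  assumes "regular_diagram D" "regular_diagram D'"
    and f: "f \<in> quandle_isos (alexander_quandle D) (alexander_quandle D')"
    and compat: "compatible_reindexing D D' f \<pi> \<pi>'"
    and ks: "distinct ks" "set ks \<subseteq> {..<length D}"
  shows "sublink_comparison D (map \<pi> ks) D' (map \<pi>' ks) f"
proof -
  have p: "\<pi> permutes {..<length D}" "\<pi>' permutes {..<length D}" "length D' = length D"
    and orb: "\<And>i. i < length D \<Longrightarrow> f ` component_orbit D (\<pi> i) = component_orbit D' (\<pi>' i)"
    using compat by (auto simp: compatible_reindexing_def)
  interpret source: subdiagram D "map \<pi> ks"
    using assms(1) ks permutes_inj_on[OF p(1)] permutes_in_image[OF p(1)]
    by unfold_locales (auto simp: distinct_map)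
  interpret target: subdiagram D' "map \<pi>' ks"
    using assms(2) ks permutes_inj_on[OF p(2)] permutes_in_image[OF p(2)] p(3)
    by unfold_locales (auto simp: distinct_map)
  have orb': "f x \<in> target.orbit (\<pi>' i)" if "x \<in> source.orbit (\<pi> i)" "i < length D" for x i
  proof -
    have "\<pi> i < length D" "\<pi>' i < length D'"
      using permutes_in_image[OF p(1), of i] permutes_in_image[OF p(2), of i] that(2) p(3) by simp_all
    then have "f ` source.orbit (\<pi> i) = target.orbit (\<pi>' i)"
      using orb[OF that(2)] source.component_orbit_eq target.component_orbit_eq by simp
    then show ?thesis using that(1) by blast
  qed
  show ?thesis
  proof unfold_locales
    show "length (map \<pi> ks) = length (map \<pi>' ks)" by simp
    show "f (alexander_op D x y) = alexander_op D' (f x) (f y)"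
      "f (alexander_op_inv D x y) = alexander_op_inv D' (f x) (f y)"
      if "x \<in> alexander_set D" "y \<in> alexander_set D" for x y
      using f that by (auto simp: quandle_isos_def alexander_quandle_def)
    show "f x \<in> target.orbit (map \<pi>' ks ! j)"
      if "j < length (map \<pi> ks)" "x \<in> source.orbit (map \<pi> ks ! j)" for j x
    proof -
      have "ks ! j \<in> set ks" using that(1) by simp
      then have "ks ! j < length D" using ks(2) by blast
      then show ?thesis using orb'[of x "ks ! j"] that by simp
    qed
    show "\<exists>i'. i' \<notin> set (map \<pi>' ks) \<and> f x \<in> target.orbit i'"
      if x: "x \<in> source.orbit i" "i \<notin> set (map \<pi> ks)" for x i
    proof -
      have "i \<in> \<pi> ` {..<length D}"
        using source.orbit_index[OF x(1)] permutes_image[OF p(1)] by simp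
      then obtain k where k: "k < length D" "i = \<pi> k" by auto
      then have "k \<notin> set ks" using x(2) by auto
      then have "\<pi>' k \<notin> set (map \<pi>' ks)"
        using permutes_inj[OF p(2)] by (auto dest: injD)
      then show ?thesis using orb' x(1) k by blast
    qed
  qed
qed

lemma compatible_reindexing_inverse:
  assumes "regular_diagram D" "regular_diagram D'"
    and f: "f \<in> quandle_isos (alexander_quandle D) (alexander_quandle D')"
    and compat: "compatible_reindexing D D' f \<pi> \<pi>'"
  shows "compatible_reindexing D' D (inv_into (alexander_set D) f) \<pi>' \<pi>"
proof -
  interpret D: diagram D by unfold_locales fact
  have p: "\<pi> permutes {..<length D}" "\<pi>' permutes {..<length D'}" "length D' = length D"
    and orb: "\<And>i. i < length D \<Longrightarrow> f ` component_orbit D (\<pi> i) = component_orbit D' (\<pi>' i)"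
    using compat by (auto simp: compatible_reindexing_def)
  have inj: "inj_on f (alexander_set D)"
    using f by (simp add: quandle_isos_def alexander_quandle_def bij_betw_def)
  have "inv_into (alexander_set D) f ` component_orbit D' (\<pi>' i) = component_orbit D (\<pi> i)" if i: "i < length D'" for i
  proof -
    have "\<pi> i < length D" using permutes_in_image[OF p(1), of i] i p(3) by simp
    then have "component_orbit D (\<pi> i) \<subseteq> alexander_set D"
      using D.component_orbit_eq D.orbit_subset by auto
    then show ?thesis
      using orb[of i] i p(3) inv_into_image_cancel[OF inj] by metis
  qed
  then show ?thesis using p by (simp add: compatible_reindexing_def)
qed

theorem theorem5:
  fixes L L' :: "(real \<Rightarrow> sphere3) list"
    and D D' :: diagram
    and f :: "alexander_element \<Rightarrow> alexander_element"
  assumes "classical_link L" and "classical_link L'"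
    and "diagram_of D L" and "diagram_of D' L'"
    and "f \<in> quandle_isos (alexander_quandle D) (alexander_quandle D')"
  shows "length L = length L' \<and>
    (\<exists>\<pi> \<pi>'. compatible_reindexing D D' f \<pi> \<pi>') \<and>
    (\<forall>\<pi> \<pi>' S. compatible_reindexing D D' f \<pi> \<pi>' \<and> S \<subseteq> {..<length L} \<longrightarrow>
      diagram_of (sublink (reindex \<pi> D) S) (sublink (reindex \<pi> L) S) \<and>
      diagram_of (sublink (reindex \<pi>' D') S) (sublink (reindex \<pi>' L') S) \<and>
      quandle_isomorphic (alexander_quandle (sublink (reindex \<pi> D) S))
        (alexander_quandle (sublink (reindex \<pi>' D') S)))"
proof -
  have reg: "regular_diagram D" "regular_diagram D'"
    using assms(3,4) by (simp_all add: diagram_of_def)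
  have len: "length D = length L" "length D' = length L'"
    using assms(3,4) by (simp_all add: diagram_of_def ambient_isotopic_def in_S3_def)
  interpret D: diagram D by unfold_locales (rule reg(1))
  note ex = compatible_reindexing_exists[OF reg assms(5)]
  define g where "g = inv_into (alexander_set D) f"
  have g: "g \<in> quandle_isos (alexander_quandle D') (alexander_quandle D)"
    using quandle_isos_inverse[OF D.closed_alexander_quandle assms(5)]
    by (simp add: g_def alexander_quandle_def)
  have bij: "bij_betw f (alexander_set D) (alexander_set D')"
    using assms(5) by (simp add: quandle_isos_def alexander_quandle_def)
  have "diagram_of (sublink (reindex \<pi> D) S) (sublink (reindex \<pi> L) S) \<and>
      diagram_of (sublink (reindex \<pi>' D') S) (sublink (reindex \<pi>' L') S) \<and>
      quandle_isomorphic (alexander_quandle (sublink (reindex \<pi> D) S))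
        (alexander_quandle (sublink (reindex \<pi>' D') S))"
    if compat: "compatible_reindexing D D' f \<pi> \<pi>'" for \<pi> \<pi>' S
  proof -
    have p: "\<pi> permutes {..<length L}" "\<pi>' permutes {..<length L'}"
      using compat unfolding len[symmetric] compatible_reindexing_def by blast+
    define ks where "ks = nths [0..<length L] S"
    have ks: "distinct ks" "set ks \<subseteq> {..<length D}" "set ks \<subseteq> {..<length D'}"
      using set_nths_subset[of "[0..<length L]" S] ex(1) len by (auto simp: ks_def)
    have sub: "sublink (reindex \<pi> D) S = map ((!) D) (map \<pi> ks)" "sublink (reindex \<pi> L) S = map ((!) L) (map \<pi> ks)"
      "sublink (reindex \<pi>' D') S = map ((!) D') (map \<pi>' ks)" "sublink (reindex \<pi>' L') S = map ((!) L') (map \<pi>' ks)"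
      using p ex(1) len by (simp_all add: sublink_reindex ks_def)
    have idx: "distinct (map \<pi> ks)" "set (map \<pi> ks) \<subseteq> {..<length L}"
      "distinct (map \<pi>' ks)" "set (map \<pi>' ks) \<subseteq> {..<length L'}"
      using ks len p permutes_inj_on permutes_in_image[OF p(1)] permutes_in_image[OF p(2)]
      by (auto simp: distinct_map)
    have "quandle_isomorphic (alexander_quandle (map ((!) D) (map \<pi> ks))) (alexander_quandle (map ((!) D') (map \<pi>' ks)))"
    proof (rule comparison_iso)
      show "sublink_comparison D (map \<pi> ks) D' (map \<pi>' ks) f"
        by (rule sublink_comparison_of_reindexing[OF reg assms(5) compat ks(1,2)])
      show "sublink_comparison D' (map \<pi>' ks) D (map \<pi> ks) g"
        unfolding g_def
        by (rule sublink_comparison_of_reindexing[OF reg(2,1) g[unfolded g_def]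
              compatible_reindexing_inverse[OF reg assms(5) compat] ks(1,3)])
      show "g (f x) = x" if "x \<in> alexander_set D" for x
        using bij_betw_inv_into_left[OF bij that] by (simp add: g_def)
      show "f (g y) = y" if "y \<in> alexander_set D'" for y
        using bij_betw_inv_into_right[OF bij that] by (simp add: g_def)
    qed
    then show ?thesis
      unfolding sub using diagram_of_sublink[OF assms(3) idx(1,2)] diagram_of_sublink[OF assms(4) idx(3,4)] by blast
  qed
  then show ?thesis using ex len by auto
qed

end
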